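(* The theory $\mathsf{KP}^{\mathcal{P}}$ proves every instance of $\Sigma_1^{\mathcal{P}}$-$\mathsf{Foundation}$; that is, $\mathsf{KP}^{\mathcal{P}} \vdash \Sigma_1^{\mathcal{P}}\text{-}\mathsf{Foundation}$.
   Context: All formulae are in the language $\mathcal{L}=\{\in,=\}$ of set theory, in classical first-order logic. Formula classes. $\Delta_0$: smallest class closed under propositional connectives and bounded quantification $\exists x\in y$, $\forall x\in y$. $\Delta_0^{\mathcal{P}}$: smallest class of $\mathcal{L}$-formulae closed under propositional connectives and quantification of the forms $\mathcal{Q}x\in y$ and $\mathcal{Q}x\subseteq y$, where $\mathcal{Q}\in\{\exists,\forall\}$ and $x,y$ are distinct variables. $\Sigma_1^{\mathcal{P}}$ (resp. $\Pi_1^{\mathcal{P}}$) formulae are those obtained from $\Delta_0^{\mathcal{P}}$ formulae by prefixing unbounded existential (resp. universal) quantifiers. Schemes, for a class $\Gamma$ of formulae. $\Gamma$-Separation: for $\phi(x,\vec z)\in\Gamma$, $\forall\vec z\forall w\exists y\forall x(x\in y\iff x\in w\wedge\phi(x,\vec z))$. $\Gamma$-Collection: for $\phi(x,y,\vec z)\in\Gamma$, $\forall\vec z\forall w((\forall x\in w)\exists y\,\phi\Rightarrow\exists C(\forall x\in w)(\exists y\in C)\phi)$. $\Gamma$-Foundation: for $\phi(x,\vec z)\in\Gamma$, $\forall\vec z(\exists x\,\phi(x,\vec z)\Rightarrow\exists y(\phi(y,\vec z)\wedge(\forall x\in y)\neg\phi(x,\vec z)))$. Set-foundation is $\Gamma$-Foundation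 for $\Gamma=\{x\in z\}$. Theories. $\mathsf{M}$: Extensionality, Emptyset, Pair, Union, Set difference ($x\setminus y$ exists), Powerset, $\mathsf{TCo}$ (every set is contained in a transitive set), Infinity, $\Delta_0$-Separation, Set-foundation. $\mathsf{KP}^{\mathcal{P}}$: $\mathsf{M}$ plus $\Delta_0^{\mathcal{P}}$-Collection plus $\Pi_1^{\mathcal{P}}$-Foundation. (The axiom of choice is not included.) *)

theory Defs
  imports Main
begin

section \<open>First-order formulae over membership and equality\<close>

text \<open>
  Variables are de Bruijn indices. The language has no function symbols, so the terms are the
  variables and every substitution is a renaming of indices.
\<close>

datatype fm =
    Mem nat nat
  | Eq nat nat
  | Fls
  | Imp fm fm
  | And fm fm
  | Or fm fm
  | All fm
  | Ex fm

abbreviation Neg :: "fm \<Rightarrow> fm" where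
  "Neg p \<equiv> Imp p Fls"

abbreviation Iff :: "fm \<Rightarrow> fm \<Rightarrow> fm" where
  "Iff p q \<equiv> And (Imp p q) (Imp q p)"

primrec fv :: "fm \<Rightarrow> nat set" where
  "fv (Mem i j) = {i, j}"
| "fv (Eq i j) = {i, j}"
| "fv Fls = {}"
| "fv (Imp p q) = fv p \<union> fv q"
| "fv (And p q) = fv p \<union> fv q"
| "fv (Or p q) = fv p \<union> fv q"
| "fv (All p) = {i. Suc i \<in> fv p}"
| "fv (Ex p) = {i. Suc i \<in> fv p}"

definition up :: "(nat \<Rightarrow> nat) \<Rightarrow> nat \<Rightarrow> nat" where
  "up f = case_nat 0 (\<lambda>i. Suc (f i))"

primrec ren :: "(nat \<Rightarrow> nat) \<Rightarrow> fm \<Rightarrow> fm" where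
  "ren f (Mem i j) = Mem (f i) (f j)"
| "ren f (Eq i j) = Eq (f i) (f j)"
| "ren f Fls = Fls"
| "ren f (Imp p q) = Imp (ren f p) (ren f q)"
| "ren f (And p q) = And (ren f p) (ren f q)"
| "ren f (Or p q) = Or (ren f p) (ren f q)"
| "ren f (All p) = All (ren (up f) p)"
| "ren f (Ex p) = Ex (ren (up f) p)"

abbreviation shift :: "fm \<Rightarrow> fm" where
  "shift \<equiv> ren Suc"

text \<open>Instantiation of index 0 by the variable \<open>t\<close>; the remaining indices move down by one.\<close>

definition inst :: "nat \<Rightarrow> fm \<Rightarrow> fm" where
  "inst t p = ren (case_nat t (\<lambda>i. i)) p"


section \<open>Derivability in classical first-order logic with equality\<close>

text \<open>
  Natural deduction. Shifting all hypotheses makes index 0 fresh, which is the eigenvariable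
  condition of the rules \<open>AllI\<close> and \<open>ExE\<close>. The set of hypotheses may be infinite, but each
  derivation uses only finitely many of them.
\<close>

inductive derives :: "fm set \<Rightarrow> fm \<Rightarrow> bool"  (infix "\<turnstile>" 50) where
  Assm: "p \<in> G \<Longrightarrow> G \<turnstile> p"
| Class: "insert (Neg p) G \<turnstile> Fls \<Longrightarrow> G \<turnstile> p"
| ImpI: "insert p G \<turnstile> q \<Longrightarrow> G \<turnstile> Imp p q"
| ImpE: "G \<turnstile> Imp p q \<Longrightarrow> G \<turnstile> p \<Longrightarrow> G \<turnstile> q"
| AndI: "G \<turnstile> p \<Longrightarrow> G \<turnstile> q \<Longrightarrow> G \<turnstile> And p q"
| AndE1: "G \<turnstile> And p q \<Longrightarrow> G \<turnstile> p"
| AndE2: "G \<turnstile> And p q \<Longrightarrow> G \<turnstile> q"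
| OrI1: "G \<turnstile> p \<Longrightarrow> G \<turnstile> Or p q"
| OrI2: "G \<turnstile> q \<Longrightarrow> G \<turnstile> Or p q"
| OrE: "G \<turnstile> Or p q \<Longrightarrow> insert p G \<turnstile> r \<Longrightarrow> insert q G \<turnstile> r \<Longrightarrow> G \<turnstile> r"
| AllI: "shift ` G \<turnstile> p \<Longrightarrow> G \<turnstile> All p"
| AllE: "G \<turnstile> All p \<Longrightarrow> G \<turnstile> inst t p"
| ExI: "G \<turnstile> inst t p \<Longrightarrow> G \<turnstile> Ex p"
| ExE: "G \<turnstile> Ex p \<Longrightarrow> insert p (shift ` G) \<turnstile> shift q \<Longrightarrow> G \<turnstile> q"
| EqI: "G \<turnstile> Eq t t"
| EqE: "G \<turnstile> Eq s t \<Longrightarrow> G \<turnstile> inst s p \<Longrightarrow> G \<turnstile> inst t p"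


section \<open>Formula classes\<close>

abbreviation Sub :: "nat \<Rightarrow> nat \<Rightarrow> fm" where
  "Sub i j \<equiv> All (Imp (Mem 0 (Suc i)) (Mem 0 (Suc j)))"

text \<open>
  In a bounded quantifier the bounding variable \<open>y\<close> is an index of the context outside the
  quantifier, so it is automatically distinct from the bound variable.
\<close>

abbreviation AllIn :: "nat \<Rightarrow> fm \<Rightarrow> fm" where
  "AllIn y p \<equiv> All (Imp (Mem 0 (Suc y)) p)"

abbreviation ExIn :: "nat \<Rightarrow> fm \<Rightarrow> fm" where
  "ExIn y p \<equiv> Ex (And (Mem 0 (Suc y)) p)"

abbreviation AllSub :: "nat \<Rightarrow> fm \<Rightarrow> fm" where
  "AllSub y p \<equiv> All (Imp (Sub 0 (Suc y)) p)"

abbreviation ExSub :: "nat \<Rightarrow> fm \<Rightarrow> fm" where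
  "ExSub y p \<equiv> Ex (And (Sub 0 (Suc y)) p)"

inductive_set Delta0 :: "fm set" where
  "Mem i j \<in> Delta0"
| "Eq i j \<in> Delta0"
| "Fls \<in> Delta0"
| "p \<in> Delta0 \<Longrightarrow> q \<in> Delta0 \<Longrightarrow> Imp p q \<in> Delta0"
| "p \<in> Delta0 \<Longrightarrow> q \<in> Delta0 \<Longrightarrow> And p q \<in> Delta0"
| "p \<in> Delta0 \<Longrightarrow> q \<in> Delta0 \<Longrightarrow> Or p q \<in> Delta0"
| "p \<in> Delta0 \<Longrightarrow> AllIn y p \<in> Delta0"
| "p \<in> Delta0 \<Longrightarrow> ExIn y p \<in> Delta0"

inductive_set Delta0P :: "fm set" where
  "Mem i j \<in> Delta0P"
| "Eq i j \<in> Delta0P"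
| "Fls \<in> Delta0P"
| "p \<in> Delta0P \<Longrightarrow> q \<in> Delta0P \<Longrightarrow> Imp p q \<in> Delta0P"
| "p \<in> Delta0P \<Longrightarrow> q \<in> Delta0P \<Longrightarrow> And p q \<in> Delta0P"
| "p \<in> Delta0P \<Longrightarrow> q \<in> Delta0P \<Longrightarrow> Or p q \<in> Delta0P"
| "p \<in> Delta0P \<Longrightarrow> AllIn y p \<in> Delta0P"
| "p \<in> Delta0P \<Longrightarrow> ExIn y p \<in> Delta0P"
| "p \<in> Delta0P \<Longrightarrow> AllSub y p \<in> Delta0P"
| "p \<in> Delta0P \<Longrightarrow> ExSub y p \<in> Delta0P"

inductive_set Sigma1P :: "fm set" where
  "p \<in> Delta0P \<Longrightarrow> p \<in> Sigma1P"
| "p \<in> Sigma1P \<Longrightarrow> Ex p \<in> Sigma1P"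

inductive_set Pi1P :: "fm set" where
  "p \<in> Delta0P \<Longrightarrow> p \<in> Pi1P"
| "p \<in> Pi1P \<Longrightarrow> All p \<in> Pi1P"


section \<open>Axiom schemes\<close>

text \<open>
  The parameters \<open>z\<^sub>1, \<dots>, z\<^sub>n\<close> of an instance are quantified by the prefix \<open>All ^^ n\<close>; the
  condition on \<open>fv\<close> says that the scheme formula has no other free variables, so that every
  instance is a sentence. In the scheme formulae of \<open>Separation\<close> and \<open>Foundation\<close> the variable
  \<open>x\<close> has index 0 and the parameters have the indices from 1 on. In those of \<open>Collection\<close>, \<open>y\<close>
  has index 0, \<open>x\<close> has index 1 and the parameters have the indices from 2 on. The renamings only
  make the parameters skip the additional variables bound by the scheme.
\<close>

definition Separation :: "fm set \<Rightarrow> fm set" where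
  "Separation \<Gamma> =
     {(All ^^ n) (All (Ex (All (Iff (Mem 0 1) (And (Mem 0 2) (ren (up (\<lambda>i. i + 2)) p)))))) | n p.
        p \<in> \<Gamma> \<and> fv p \<subseteq> {..<n + 1}}"

definition Collection :: "fm set \<Rightarrow> fm set" where
  "Collection \<Gamma> =
     {(All ^^ n) (All (Imp
        (AllIn 0 (Ex (ren (up (up Suc)) p)))
        (Ex (AllIn 1 (ExIn 1 (ren (up (up (\<lambda>i. i + 2))) p)))))) | n p.
        p \<in> \<Gamma> \<and> fv p \<subseteq> {..<n + 2}}"

definition Foundation :: "fm set \<Rightarrow> fm set" where
  "Foundation \<Gamma> =
     {(All ^^ n) (Imp (Ex p) (Ex (And p (AllIn 0 (Neg (ren (up Suc) p)))))) | n p.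
        p \<in> \<Gamma> \<and> fv p \<subseteq> {..<n + 1}}"


section \<open>The theories\<close>

definition Extensionality :: fm where
  "Extensionality = All (All (Imp (All (Iff (Mem 0 2) (Mem 0 1))) (Eq 1 0)))"

definition Emptyset :: fm where
  "Emptyset = Ex (All (Neg (Mem 0 1)))"

definition Pairing :: fm where
  "Pairing = All (All (Ex (All (Iff (Mem 0 1) (Or (Eq 0 3) (Eq 0 2))))))"

definition Union_ax :: fm where
  "Union_ax = All (Ex (All (Iff (Mem 0 1) (ExIn 2 (Mem 1 0)))))"

definition Set_difference :: fm where
  "Set_difference = All (All (Ex (All (Iff (Mem 0 1) (And (Mem 0 3) (Neg (Mem 0 2)))))))"

definition Powerset :: fm where
  "Powerset = All (Ex (All (Iff (Mem 0 1) (Sub 0 2))))"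

definition TCo :: fm where
  "TCo = All (Ex (And (Sub 1 0) (AllIn 0 (Sub 0 1))))"

text \<open>
  There is a set \<open>x\<close> that contains an empty set and, with each \<open>y\<close>, also a set \<open>s\<close> whose
  elements are \<open>y\<close> and the elements of \<open>y\<close>.
\<close>

definition Infinity :: fm where
  "Infinity = Ex (And
     (ExIn 0 (All (Neg (Mem 0 1))))
     (AllIn 0 (ExIn 1 (All (Iff (Mem 0 1) (Or (Mem 0 2) (Eq 0 2)))))))"

text \<open>Set-foundation is the foundation scheme for the single formula \<open>x \<in> z\<close>.\<close>

definition M :: "fm set" where
  "M = {Extensionality, Emptyset, Pairing, Union_ax, Set_difference, Powerset, TCo, Infinity}
       \<union> Separation Delta0 \<union> Foundation {Mem 0 1}"

definition KPP :: "fm set" where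
  "KPP = M \<union> Collection Delta0P \<union> Foundation Pi1P"

end

theory Submission imports Defs "HOL-Library.Countable_Set"
begin

text \<open>
  By completeness it suffices to work in a model. \<open>Pi1P\<close>-foundation is induction for
  \<open>\<Sigma>\<^sub>1\<^sup>P\<close> properties. It shows that every set lies in a level of the cumulative hierarchy, and
  being a level is a \<open>Delta0P\<close> property. Now suppose that the class of all \<open>x\<close> with
  \<open>\<exists>y. \<theta> y x\<close> contains \<open>x0\<close> and has no minimal element, and let \<open>T\<close> be a transitive set
  with \<open>x0 \<in> T\<close>. By collection, for each set \<open>u\<close> there is a least level \<open>v\<close> such that every
  \<open>x \<in> T\<close> with a witness in \<open>u\<close> has an element with a witness in \<open>v\<close>. Taking the least level
  makes this step unique, so \<open>\<Sigma>\<^sub>1\<^sup>P\<close> induction allows to iterate it along an infinite set, and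
  this without any choice. The elements of \<open>T\<close> that have a witness in the union of the
  iterates form a nonempty set without a minimal element, which contradicts set foundation.
\<close>

section \<open>Renaming\<close>

text \<open>\<open>Pi1P\<close>-foundation gives minimal elements of \<open>Pi1P\<close> classes,
  that is, of the complement of the class in question. Descending from \<open>x0\<close> one element
  at a time would need dependent choice, while collection bounds the witnesses of a single step
  only; so whole sets of witnesses are iterated instead of elements. The least level is unique
  because levels are linearly ordered by membership. The recursion runs along membership, with
  arbitrary sets as arguments, so neither ordinals nor natural numbers have to be singled out in the
  model: the set from the axiom of infinity is itself an argument, and the value there bounds all
  values at its elements. The induction hypotheses available are \<open>Delta0P\<close>, or one
  existential quantifier in front of \<open>Delta0P\<close>. This is why the set-theoretic
  definitions bound each quantifier by a set at hand, and why some inductions are preceded by the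
  choice of a set that bounds a quantifier. Completeness has to fix one carrier type;
  \<open>nat\<close> is enough because models of \<open>M\<close> are infinite.\<close>

lemma up_simps [simp]: "up f 0 = 0" "up f (Suc i) = Suc (f i)"
  by (simp_all add: up_def)

lemma up_comp: "up f \<circ> up g = up (f \<circ> g)"
proof
  show "(up f \<circ> up g) i = up (f \<circ> g) i" for i by (cases i) auto
qed

lemma up_ident: "up (\<lambda>i. i) = (\<lambda>i. i)"
proof
  show "up (\<lambda>i. i) i = i" for i by (cases i) auto
qed

lemma ren_ren: "ren f (ren g p) = ren (f \<circ> g) p"
  by (induction p arbitrary: f g) (auto simp: up_comp)

lemma up_cong: "(\<And>i. Suc i \<in> A \<Longrightarrow> f i = g i) \<Longrightarrow> j \<in> A \<Longrightarrow> up f j = up g j"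
  by (cases j) simp_all

lemma ren_cong: "(\<And>i. i \<in> fv p \<Longrightarrow> f i = g i) \<Longrightarrow> ren f p = ren g p"
proof (induction p arbitrary: f g)
  case (Imp p q)
  show ?case using Imp.IH[of f g] Imp.prems by simp
next
  case (And p q)
  show ?case using And.IH[of f g] And.prems by simp
next
  case (Or p q)
  show ?case using Or.IH[of f g] Or.prems by simp
next
  case (All p)
  show ?case using All.IH[OF up_cong[of "fv p" f g]] All.prems by simp
next
  case (Ex p)
  show ?case using Ex.IH[OF up_cong[of "fv p" f g]] Ex.prems by simp
qed auto

lemma ren_ident: "ren (\<lambda>i. i) p = p"
  by (induction p) (auto simp: up_ident)

lemma Suc_in_up_image: "Suc i \<in> up f ` A \<longleftrightarrow> i \<in> f ` {i. Suc i \<in> A}"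
proof
  assume "Suc i \<in> up f ` A"
  then obtain j where "j \<in> A" "Suc i = up f j" by blast
  then show "i \<in> f ` {i. Suc i \<in> A}" by (cases j) auto
next
  assume "i \<in> f ` {i. Suc i \<in> A}"
  then obtain j where "Suc j \<in> A" "i = f j" by blast
  then have "Suc i = up f (Suc j)" by simp
  with \<open>Suc j \<in> A\<close> show "Suc i \<in> up f ` A" by (rule image_eqI[rotated])
qed

lemma fv_ren: "fv (ren f p) = f ` fv p"
  by (induction p arbitrary: f) (auto simp: Suc_in_up_image)

lemma finite_fv: "finite (fv p)"
proof (induction p)
  case (All p)
  then have "finite (Suc -` fv p)" by (simp add: finite_vimageI)
  then show ?case by (simp add: vimage_def)
next
  case (Ex p)
  then have "finite (Suc -` fv p)" by (simp add: finite_vimageI)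
  then show ?case by (simp add: vimage_def)
qed auto

lemma ren_closed: "fv p = {} \<Longrightarrow> ren f p = p"
  using ren_cong[of p f "\<lambda>i. i"] by (simp add: ren_ident)

lemma ren_inst: "ren f (inst t p) = inst (f t) (ren (up f) p)"
proof -
  have "f \<circ> case_nat t (\<lambda>i. i) = case_nat (f t) (\<lambda>i. i) \<circ> up f"
    by (rule ext) (simp split: nat.split add: up_def)
  then show ?thesis by (simp add: inst_def ren_ren)
qed

lemma inst_ren_up: "inst c (ren (up f) p) = ren (case_nat c f) p"
proof -
  have "case_nat c (\<lambda>i. i) \<circ> up f = case_nat c f"
    by (rule ext) (simp split: nat.split add: up_def)
  then show ?thesis by (simp add: inst_def ren_ren)
qed

lemma ren_up_shift: "ren (up f) (shift p) = shift (ren f p)"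
proof -
  have "up f \<circ> Suc = Suc \<circ> f" by auto
  then show ?thesis by (simp add: ren_ren)
qed


section \<open>Completeness\<close>

lemma weakening: "G \<turnstile> p \<Longrightarrow> G \<subseteq> H \<Longrightarrow> H \<turnstile> p"
proof (induction arbitrary: H rule: derives.induct)
  case (Class p G)
  show ?case by (rule derives.Class[OF Class.IH[OF insert_mono[OF Class.prems]]])
next
  case (ImpI p G q)
  show ?case by (rule derives.ImpI[OF ImpI.IH[OF insert_mono[OF ImpI.prems]]])
next
  case (OrE G p q r)
  show ?case
    by (rule derives.OrE[OF OrE.IH(1)[OF OrE.prems] OrE.IH(2,3)[OF insert_mono[OF OrE.prems]]])
next
  case (AllI G p)
  show ?case by (rule derives.AllI[OF AllI.IH[OF image_mono[OF AllI.prems]]])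
next
  case (ExE G p q)
  show ?case
    by (rule derives.ExE[OF ExE.IH(1)[OF ExE.prems] ExE.IH(2)[OF insert_mono[OF image_mono[OF ExE.prems]]]])
next
  case (Assm p G)
  show ?case by (rule derives.Assm[OF subsetD[OF Assm(2,1)]])
next
  case (ImpE G p q)
  show ?case by (rule derives.ImpE[OF ImpE.IH[OF ImpE.prems]])
next
  case (AndI G p q)
  show ?case by (rule derives.AndI[OF AndI.IH[OF AndI.prems]])
next
  case (AndE1 G p q)
  show ?case by (rule derives.AndE1[OF AndE1.IH[OF AndE1.prems]])
next
  case (AndE2 G p q)
  show ?case by (rule derives.AndE2[OF AndE2.IH[OF AndE2.prems]])
next
  case (OrI1 G p q)
  show ?case by (rule derives.OrI1[OF OrI1.IH[OF OrI1.prems]])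
next
  case (OrI2 G q p)
  show ?case by (rule derives.OrI2[OF OrI2.IH[OF OrI2.prems]])
next
  case (AllE G p t)
  show ?case by (rule derives.AllE[OF AllE.IH[OF AllE.prems]])
next
  case (ExI G t p)
  show ?case by (rule derives.ExI[OF ExI.IH[OF ExI.prems]])
next
  case (EqI G t)
  show ?case by (rule derives.EqI)
next
  case (EqE G s t p)
  show ?case by (rule derives.EqE[OF EqE.IH[OF EqE.prems]])
qed

lemma cut: "G \<turnstile> p \<Longrightarrow> insert p G \<turnstile> q \<Longrightarrow> G \<turnstile> q"
  by (rule ImpE[OF ImpI])

text \<open>Works for arbitrary \<open>f\<close> because the eigenvariable is index 0, which
  \<open>up f\<close> fixes, and because \<open>up f\<close> commutes with the shift of the
  hypotheses. This later turns a fresh witness variable into an eigenvariable.\<close>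

lemma derives_ren: "G \<turnstile> p \<Longrightarrow> ren f ` G \<turnstile> ren f p"
proof (induction arbitrary: f rule: derives.induct)
  case (Assm p G)
  then show ?case by (simp add: derives.Assm)
next
  case (Class p G)
  have "insert (Neg (ren f p)) (ren f ` G) \<turnstile> Fls" using Class.IH[of f] by simp
  then show ?case by (rule derives.Class)
next
  case (ImpI p G q)
  have "insert (ren f p) (ren f ` G) \<turnstile> ren f q" using ImpI.IH[of f] by simp
  then show ?case by (simp add: derives.ImpI)
next
  case (ImpE G p q)
  show ?case using ImpE.IH(1)[of f, simplified] ImpE.IH(2)[of f] by (rule derives.ImpE)
next
  case (AndI G p q)
  show ?case using derives.AndI[OF AndI.IH] by simp
next
  case (AndE1 G p q)
  show ?case using AndE1.IH[of f, simplified] by (rule derives.AndE1)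
next
  case (AndE2 G p q)
  show ?case using AndE2.IH[of f, simplified] by (rule derives.AndE2)
next
  case (OrI1 G p q)
  show ?case using derives.OrI1[OF OrI1.IH] by simp
next
  case (OrI2 G q p)
  show ?case using derives.OrI2[OF OrI2.IH] by simp
next
  case (OrE G p q r)
  have "insert (ren f p) (ren f ` G) \<turnstile> ren f r" using OrE.IH(2)[of f] by simp
  moreover have "insert (ren f q) (ren f ` G) \<turnstile> ren f r" using OrE.IH(3)[of f] by simp
  ultimately show ?case by (rule derives.OrE[OF OrE.IH(1)[of f, simplified]])
next
  case (AllI G p)
  have "ren (up f) ` shift ` G = shift ` ren f ` G" by (auto simp: image_image ren_up_shift)
  then show ?case using AllI.IH[of "up f"] by (simp add: derives.AllI)
next
  case (AllE G p t)
  show ?case unfolding ren_inst using AllE.IH[of f, simplified] by (rule derives.AllE)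
next
  case (ExI G t p)
  show ?case using derives.ExI[OF ExI.IH[of f, unfolded ren_inst]] by simp
next
  case (ExE G p q)
  have "ren (up f) ` shift ` G = shift ` ren f ` G" by (auto simp: image_image ren_up_shift)
  then have "insert (ren (up f) p) (shift ` ren f ` G) \<turnstile> shift (ren f q)"
    using ExE.IH(2)[of "up f"] by (simp add: ren_up_shift)
  then show ?case by (rule derives.ExE[OF ExE.IH(1)[of f, simplified]])
next
  case (EqI G t)
  show ?case by (simp add: derives.EqI)
next
  case (EqE G s t p)
  show ?case unfolding ren_inst
    using EqE.IH(1)[of f, simplified] EqE.IH(2)[of f, unfolded ren_inst] by (rule derives.EqE)
qed

text \<open>Compactness, which makes the union of an increasing chain of consistent sets consistent.
  In the rules that shift the hypotheses, a finite set of shifted formulae is pulled back to a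
  finite set of originals.\<close>

lemma derives_finite: "G \<turnstile> p \<Longrightarrow> \<exists>F. finite F \<and> F \<subseteq> G \<and> F \<turnstile> p"
proof (induction rule: derives.induct)
  case (Assm p G)
  have "{p} \<turnstile> p" by (simp add: derives.Assm)
  with Assm show ?case by (intro exI[of _ "{p}"]) auto
next
  case (Class p G)
  then obtain F where F: "finite F" "F \<subseteq> insert (Neg p) G" "F \<turnstile> Fls" by auto
  have "insert (Neg p) (F - {Neg p}) \<turnstile> Fls" using F(3) by (rule weakening) auto
  then have "F - {Neg p} \<turnstile> p" by (rule derives.Class)
  with F show ?case by (intro exI[of _ "F - {Neg p}"]) auto
next
  case (ImpI p G q)
  then obtain F where F: "finite F" "F \<subseteq> insert p G" "F \<turnstile> q" by auto
  have "insert p (F - {p}) \<turnstile> q" using F(3) by (rule weakening) auto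
  then have "F - {p} \<turnstile> Imp p q" by (rule derives.ImpI)
  with F show ?case by (intro exI[of _ "F - {p}"]) auto
next
  case (ImpE G p q)
  then obtain F F' where F: "finite F" "F \<subseteq> G" "F \<turnstile> Imp p q" "finite F'" "F' \<subseteq> G" "F' \<turnstile> p"
    by auto
  then have "F \<union> F' \<turnstile> q" by (meson derives.ImpE weakening Un_upper1 Un_upper2)
  with F show ?case by (intro exI[of _ "F \<union> F'"]) auto
next
  case (AndI G p q)
  then obtain F F' where F: "finite F" "F \<subseteq> G" "F \<turnstile> p" "finite F'" "F' \<subseteq> G" "F' \<turnstile> q"
    by auto
  then have "F \<union> F' \<turnstile> And p q" by (meson derives.AndI weakening Un_upper1 Un_upper2)
  with F show ?case by (intro exI[of _ "F \<union> F'"]) auto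
next
  case (OrE G p q r)
  then obtain F F1 F2 where F: "finite F" "F \<subseteq> G" "F \<turnstile> Or p q"
    "finite F1" "F1 \<subseteq> insert p G" "F1 \<turnstile> r" "finite F2" "F2 \<subseteq> insert q G" "F2 \<turnstile> r" by auto
  let ?F = "F \<union> (F1 - {p}) \<union> (F2 - {q})"
  have "?F \<turnstile> Or p q" using F(3) by (rule weakening) auto
  moreover have "insert p ?F \<turnstile> r" using F(6) by (rule weakening) auto
  moreover have "insert q ?F \<turnstile> r" using F(9) by (rule weakening) auto
  ultimately have "?F \<turnstile> r" by (rule derives.OrE)
  with F show ?case by (intro exI[of _ ?F]) auto
next
  case (AllI G p)
  then obtain F where F: "finite F" "F \<subseteq> shift ` G" "F \<turnstile> p" by auto
  then obtain F' where "F' \<subseteq> G" "finite F'" "F = shift ` F'" by (meson finite_subset_image)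
  with F show ?case by (intro exI[of _ F']) (auto intro: derives.AllI)
next
  case (ExE G p q)
  then obtain F F1 where F: "finite F" "F \<subseteq> G" "F \<turnstile> Ex p"
    "finite F1" "F1 \<subseteq> insert p (shift ` G)" "F1 \<turnstile> shift q" by auto
  then have "F1 - {p} \<subseteq> shift ` G" "finite (F1 - {p})" by auto
  then obtain F' where F': "F' \<subseteq> G" "finite F'" "F1 - {p} = shift ` F'"
    by (meson finite_subset_image)
  have "insert p (shift ` (F \<union> F')) \<turnstile> shift q" using F(6) by (rule weakening) (use F' in auto)
  moreover have "F \<union> F' \<turnstile> Ex p" using F(3) by (rule weakening) auto
  ultimately have "F \<union> F' \<turnstile> q" by (metis derives.ExE)
  with F F' show ?case by (intro exI[of _ "F \<union> F'"]) auto
next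
  case (EqE G s t p)
  then obtain F F' where F: "finite F" "F \<subseteq> G" "F \<turnstile> Eq s t" "finite F'" "F' \<subseteq> G" "F' \<turnstile> inst s p"
    by auto
  then have "F \<union> F' \<turnstile> inst t p" by (meson derives.EqE weakening Un_upper1 Un_upper2)
  with F show ?case by (intro exI[of _ "F \<union> F'"]) auto
next
  case (EqI G t)
  have "{} \<turnstile> Eq t t" by (rule derives.EqI)
  then show ?case by (intro exI[of _ "{}"]) auto
next
  case (AndE1 G p q)
  from AndE1.IH show ?case by (blast intro: derives.AndE1)
next
  case (AndE2 G p q)
  from AndE2.IH show ?case by (blast intro: derives.AndE2)
next
  case (OrI1 G p q)
  from OrI1.IH show ?case by (blast intro!: derives.OrI1)
next
  case (OrI2 G q p)
  from OrI2.IH show ?case by (blast intro!: derives.OrI2)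
next
  case (AllE G p t)
  from AllE.IH show ?case by (blast intro: derives.AllE)
next
  case (ExI G t p)
  from ExI.IH show ?case by (blast intro!: derives.ExI)
qed

section \<open>Extension to a maximal consistent set with witnesses\<close>

lemma witness_consistent:
  assumes "Ex q \<in> K" "\<And>r. r \<in> K \<Longrightarrow> c \<notin> fv r" "insert (inst c q) K \<turnstile> Fls"
  shows "K \<turnstile> Fls"
proof -
  \<comment> \<open>The variable \<open>c\<close> plays the part of a Henkin constant. The renaming
    \<open>?f\<close> sends it to 0 and shifts every other index: on formulae without
    \<open>c\<close> it is \<open>shift\<close>, and it turns the instance of \<open>q\<close> at
    \<open>c\<close> back into \<open>q\<close>. The renamed derivation is then the second premise
    of \<open>ExE\<close>.\<close>
  let ?f = "\<lambda>i. if i = c then 0 else Suc i"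
  have 1: "ren ?f r = shift r" if "r \<in> K" for r
    using assms(2)[OF that] by (intro ren_cong) auto
  have "c \<notin> fv (Ex q)" using assms(1,2) by blast
  then have "ren (?f \<circ> case_nat c (\<lambda>i. i)) q = ren (\<lambda>i. i) q"
    by (intro ren_cong) (auto split: nat.splits)
  then have 2: "ren ?f (inst c q) = q" by (simp add: inst_def ren_ren ren_ident)
  have "ren ?f ` insert (inst c q) K = insert q (shift ` K)" using 1 2 by auto
  then have "insert q (shift ` K) \<turnstile> shift Fls" using derives_ren[OF assms(3), of ?f] by simp
  then show ?thesis by (rule ExE[OF Assm[OF assms(1)]])
qed

instance fm :: countable by countable_datatype

text \<open>Each formula is considered at the stage given by its code, and an accepted existential
  formula gets its witness at that same stage. The witness is an ordinary variable that is fresh for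
  everything accepted so far; it exists when only finitely many variables are free at each
  stage.\<close>

primrec henkin :: "fm set \<Rightarrow> nat \<Rightarrow> fm set" where
  "henkin G 0 = G"
| "henkin G (Suc n) = (let p = from_nat n; K = insert p (henkin G n) in
     if K \<turnstile> Fls then henkin G n
     else K \<union> {inst (SOME c. \<forall>r\<in>K. c \<notin> fv r) q | q. p = Ex q})"

lemma finite_fv_henkin:
  assumes "finite (\<Union> (fv ` G))"
  shows "finite (\<Union> (fv ` henkin G n))"
proof (induction n)
  case (Suc n)
  let ?p = "from_nat n :: fm"
  let ?W = "{inst (SOME c. \<forall>r\<in>insert ?p (henkin G n). c \<notin> fv r) q | q. ?p = Ex q}"
  have "finite ?W" by (cases ?p) auto
  then have "finite (\<Union> (fv ` (insert ?p (henkin G n) \<union> ?W)))"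
    using Suc by (auto simp: finite_fv)
  with Suc show ?case by (auto simp: Let_def)
qed (use assms in simp)

lemma henkin_consistent:
  assumes "finite (\<Union> (fv ` G))" "\<not> G \<turnstile> Fls"
  shows "\<not> henkin G n \<turnstile> Fls"
proof (induction n)
  case (Suc n)
  let ?p = "from_nat n :: fm"
  let ?K = "insert ?p (henkin G n)"
  let ?c = "SOME c. \<forall>r\<in>?K. c \<notin> fv r"
  have "finite (\<Union> (fv ` ?K))" using finite_fv_henkin[OF assms(1), of n] by (simp add: finite_fv)
  then obtain c where "c \<notin> \<Union> (fv ` ?K)" using ex_new_if_finite infinite_UNIV_nat by blast
  then have "\<forall>r\<in>?K. c \<notin> fv r" by blast
  then have c: "\<forall>r\<in>?K. ?c \<notin> fv r" by (rule someI[of "\<lambda>c. \<forall>r\<in>?K. c \<notin> fv r"])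
  show ?case
  proof (cases "?K \<turnstile> Fls")
    case True
    with Suc show ?thesis by (simp add: Let_def)
  next
    case False
    show ?thesis
    proof (cases "\<exists>q. ?p = Ex q")
      case True
      then obtain q where q: "?p = Ex q" by auto
      have "\<not> insert (inst ?c q) ?K \<turnstile> Fls"
      proof
        assume "insert (inst ?c q) ?K \<turnstile> Fls"
        moreover have "Ex q \<in> ?K" using q by simp
        ultimately show False using witness_consistent[of q ?K ?c] c False by blast
      qed
      moreover have "{inst ?c q | q. ?p = Ex q} = {inst ?c q}" using q by auto
      ultimately show ?thesis using False by (simp add: Let_def)
    next
      case 2: False
      then have "{inst ?c q | q. ?p = Ex q} = {}" by auto
      with False show ?thesis by (simp add: Let_def)
    qed
  qed
qed (use assms in simp)

locale henkin_set =
  fixes H :: "fm set"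
  assumes cons: "\<not> H \<turnstile> Fls"
    and maximal: "\<not> insert p H \<turnstile> Fls \<Longrightarrow> p \<in> H"
    and witness: "Ex q \<in> H \<Longrightarrow> \<exists>c. inst c q \<in> H"

lemma ex_henkin_set:
  assumes "finite (\<Union> (fv ` G))" "\<not> G \<turnstile> Fls"
  shows "\<exists>H. G \<subseteq> H \<and> henkin_set H"
proof -
  define H where "H = (\<Union>n. henkin G n)"
  have step: "henkin G n \<subseteq> henkin G (Suc n)" for n by (auto simp: Let_def)
  then have mono: "m \<le> n \<Longrightarrow> henkin G m \<subseteq> henkin G n" for m n by (rule lift_Suc_mono_le)
  have cons: "\<not> H \<turnstile> Fls"
  proof
    assume "H \<turnstile> Fls"
    then obtain F where F: "finite F" "F \<subseteq> H" "F \<turnstile> Fls" using derives_finite by blast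
    from F(1,2) have "\<exists>n. F \<subseteq> henkin G n"
    proof (induction rule: finite_induct)
      case (insert p F)
      then obtain m n where "F \<subseteq> henkin G m" "p \<in> henkin G n" by (auto simp: H_def)
      then have "insert p F \<subseteq> henkin G (max m n)"
        using mono[of m "max m n"] mono[of n "max m n"] by auto
      then show ?case by blast
    qed auto
    then show False using F(3) weakening henkin_consistent[OF assms] by blast
  qed
  have sub: "henkin G n \<subseteq> H" for n by (auto simp: H_def)
  have maximal: "p \<in> H \<and> (\<forall>q. p = Ex q \<longrightarrow> (\<exists>c. inst c q \<in> H))" if "\<not> insert p H \<turnstile> Fls" for p
  proof -
    obtain n where n: "p = from_nat n" by (metis from_nat_to_nat)
    have "\<not> insert p (henkin G n) \<turnstile> Fls" using that weakening[OF _ insert_mono[OF sub]] by blast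
    then have "p \<in> henkin G (Suc n)" "\<And>q. p = Ex q \<Longrightarrow> \<exists>c. inst c q \<in> henkin G (Suc n)"
      by (auto simp: Let_def n)
    with sub show ?thesis by blast
  qed
  have "henkin_set H"
  proof
    show "\<exists>c. inst c q \<in> H" if "Ex q \<in> H" for q using maximal cons that by (metis insert_absorb)
  qed (use maximal cons in auto)
  moreover have "G \<subseteq> H" using sub[of 0] by simp
  ultimately show ?thesis by blast
qed

section \<open>Membership in a Henkin set behaves like truth\<close>

context henkin_set
begin

lemma mem_iff: "p \<in> H \<longleftrightarrow> H \<turnstile> p"
proof
  assume "H \<turnstile> p"
  then have "\<not> insert p H \<turnstile> Fls" using cut cons by blast
  then show "p \<in> H" by (rule maximal)
qed (rule Assm)

lemma Fls_H: "Fls \<notin> H"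
  using cons by (simp add: mem_iff)

lemma not_mem: "p \<notin> H \<Longrightarrow> Neg p \<in> H"
  using maximal[of p] ImpI[of p H Fls] mem_iff[of "Neg p"] by blast

lemma Imp_H: "Imp p q \<in> H \<longleftrightarrow> (p \<in> H \<longrightarrow> q \<in> H)"
proof (intro iffI impI)
  assume "Imp p q \<in> H" "p \<in> H"
  then show "q \<in> H" unfolding mem_iff by (rule ImpE)
next
  assume *: "p \<in> H \<longrightarrow> q \<in> H"
  have "insert p H \<turnstile> q"
  proof (cases "q \<in> H")
    case True
    then show ?thesis by (intro Assm) simp
  next
    case False
    then have "Neg p \<in> H" using * not_mem by blast
    then have "insert (Neg q) (insert p H) \<turnstile> Neg p" by (intro Assm) simp
    moreover have "insert (Neg q) (insert p H) \<turnstile> p" by (intro Assm) simp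
    ultimately show ?thesis by (rule Class[OF ImpE])
  qed
  then show "Imp p q \<in> H" unfolding mem_iff by (rule ImpI)
qed

lemma And_H: "And p q \<in> H \<longleftrightarrow> p \<in> H \<and> q \<in> H"
  unfolding mem_iff using AndI[of H p q] AndE1[of H p q] AndE2[of H p q] by blast

lemma Or_H: "Or p q \<in> H \<longleftrightarrow> p \<in> H \<or> q \<in> H"
proof
  assume *: "Or p q \<in> H"
  show "p \<in> H \<or> q \<in> H"
    using OrE[OF Assm[OF *], of Fls] maximal[of p] maximal[of q] cons by blast
next
  assume "p \<in> H \<or> q \<in> H"
  then show "Or p q \<in> H" unfolding mem_iff using OrI1[of H p q] OrI2[of H q p] by blast
qed

lemma Ex_H: "Ex p \<in> H \<longleftrightarrow> (\<exists>c. inst c p \<in> H)"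
proof
  assume "\<exists>c. inst c p \<in> H"
  then show "Ex p \<in> H" unfolding mem_iff using ExI[of H _ p] by blast
qed (rule witness)

lemma All_H: "All p \<in> H \<longleftrightarrow> (\<forall>c. inst c p \<in> H)"
proof
  assume "All p \<in> H"
  then show "\<forall>c. inst c p \<in> H" unfolding mem_iff using AllE[of H p] by blast
next
  assume *: "\<forall>c. inst c p \<in> H"
  show "All p \<in> H"
  proof (rule ccontr)
    assume "All p \<notin> H"
    then have neg: "Neg (All p) \<in> H" by (rule not_mem)
    \<comment> \<open>If there is no counterexample, then \<open>p\<close> holds for the fresh index
      0 created by shifting the hypotheses, as otherwise index 0 would be one. So
      \<open>All p\<close> would follow, and \<open>H\<close>, which contains its negation, must
      contain \<open>Ex (Neg p)\<close>.\<close>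
    let ?G = "insert (Neg (Ex (Neg p))) H"
    let ?K = "insert (Neg p) (shift ` ?G)"
    have "case_nat 0 Suc = (\<lambda>i. i)" by (rule ext) (simp split: nat.split)
    then have "inst 0 (ren (up Suc) (Neg p)) = Neg p" by (simp only: inst_ren_up ren_ident)
    moreover have "?K \<turnstile> Neg p" by (rule Assm) simp
    ultimately have "?K \<turnstile> Ex (ren (up Suc) (Neg p))" by (intro ExI[of _ 0]) simp
    moreover have "?K \<turnstile> Neg (Ex (ren (up Suc) (Neg p)))" by (rule Assm) simp
    ultimately have "?K \<turnstile> Fls" by (rule ImpE[rotated])
    then have "?G \<turnstile> All p" by (rule AllI[OF Class])
    moreover have "?G \<turnstile> Neg (All p)" using neg by (intro Assm) simp
    ultimately have "?G \<turnstile> Fls" by (rule ImpE[rotated])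
    then have "Ex (Neg p) \<in> H" unfolding mem_iff by (rule Class)
    then obtain c where "inst c (Neg p) \<in> H" using witness by blast
    then have "Neg (inst c p) \<in> H" by (simp add: inst_def)
    with * show False using Imp_H Fls_H by blast
  qed
qed

lemma Eq_refl_H: "Eq i i \<in> H"
  by (simp add: mem_iff EqI)

lemma Eq_subst_H: "Eq i j \<in> H \<Longrightarrow> inst i p \<in> H \<Longrightarrow> inst j p \<in> H"
  unfolding mem_iff by (rule EqE)

lemma Eq_sym_H: "Eq i j \<in> H \<Longrightarrow> Eq j i \<in> H"
  using Eq_subst_H[of i j "Eq 0 (Suc i)"] Eq_refl_H by (simp add: inst_def)

lemma Eq_trans_H: "Eq i j \<in> H \<Longrightarrow> Eq j k \<in> H \<Longrightarrow> Eq i k \<in> H"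
  using Eq_subst_H[of j k "Eq (Suc i) 0"] by (simp add: inst_def)

lemma Mem_cong_H:
  assumes "Eq i i' \<in> H" "Eq j j' \<in> H" "Mem i j \<in> H"
  shows "Mem i' j' \<in> H"
  using Eq_subst_H[of i i' "Mem 0 (Suc j)"] Eq_subst_H[of j j' "Mem (Suc i') 0"] assms
  by (simp add: inst_def)

end

section \<open>Tarski semantics and the model of equivalence classes of variables\<close>

primrec sat :: "('a \<Rightarrow> 'a \<Rightarrow> bool) \<Rightarrow> fm \<Rightarrow> (nat \<Rightarrow> 'a) \<Rightarrow> bool" where
  "sat E (Mem i j) e = E (e i) (e j)"
| "sat E (Eq i j) e = (e i = e j)"
| "sat E Fls e = False"
| "sat E (Imp p q) e = (sat E p e \<longrightarrow> sat E q e)"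
| "sat E (And p q) e = (sat E p e \<and> sat E q e)"
| "sat E (Or p q) e = (sat E p e \<or> sat E q e)"
| "sat E (All p) e = (\<forall>x. sat E p (case_nat x e))"
| "sat E (Ex p) e = (\<exists>x. sat E p (case_nat x e))"

lemma case_nat_up: "(\<lambda>i. case_nat x e (up f i)) = case_nat x (\<lambda>i. e (f i))"
  by (rule ext) (simp split: nat.split add: up_def)

lemma sat_ren: "sat E (ren f p) e = sat E p (\<lambda>i. e (f i))"
  by (induction p arbitrary: e f) (auto simp: case_nat_up)

lemma case_nat_map: "case_nat (g c) (\<lambda>i. g (f i)) = (\<lambda>i. g (case_nat c f i))"
  by (rule ext) (simp split: nat.split)

lemma all_surj:
  assumes "surj g"
  shows "(\<forall>x. P x) \<longleftrightarrow> (\<forall>c. P (g c))"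
proof (intro iffI allI)
  fix x assume "\<forall>c. P (g c)"
  moreover obtain c where "x = g c" using assms by blast
  ultimately show "P x" by simp
qed simp

lemma ex_surj: "surj g \<Longrightarrow> (\<exists>x. P x) \<longleftrightarrow> (\<exists>c. P (g c))"
  using all_surj[of g "\<lambda>x. \<not> P x"] by blast

text \<open>Variables name the elements of the model through \<open>g\<close>. The claim is made for
  every renaming \<open>f\<close>, so that choosing the element \<open>g c\<close> for a bound
  variable merely extends \<open>f\<close> by \<open>c\<close>.\<close>

lemma (in henkin_set) truth:
  fixes g :: "nat \<Rightarrow> 'a"
  assumes surj: "surj g" and g: "\<And>i j. g i = g j \<longleftrightarrow> Eq i j \<in> H"
  shows "sat (\<lambda>a b. \<exists>i j. g i = a \<and> g j = b \<and> Mem i j \<in> H) p (\<lambda>i. g (f i)) \<longleftrightarrow> ren f p \<in> H"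
    (is "sat ?E _ _ \<longleftrightarrow> _")
proof (induction p arbitrary: f)
  case (Mem i j)
  have "Mem (f i) (f j) \<in> H" if "g i' = g (f i)" "g j' = g (f j)" "Mem i' j' \<in> H" for i' j'
    using Mem_cong_H that g by blast
  then show ?case by auto
next
  case (All p)
  have "(\<forall>x. sat ?E p (case_nat x (\<lambda>i. g (f i)))) \<longleftrightarrow>
      (\<forall>c. sat ?E p (case_nat (g c) (\<lambda>i. g (f i))))"
    by (rule all_surj[OF surj])
  also have "\<dots> \<longleftrightarrow> (\<forall>c. ren (case_nat c f) p \<in> H)"
    unfolding case_nat_map All.IH ..
  finally show ?case by (simp only: sat.simps ren.simps All_H inst_ren_up)
next
  case (Ex p)
  have "(\<exists>x. sat ?E p (case_nat x (\<lambda>i. g (f i)))) \<longleftrightarrow>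
      (\<exists>c. sat ?E p (case_nat (g c) (\<lambda>i. g (f i))))"
    by (rule ex_surj[OF surj])
  also have "\<dots> \<longleftrightarrow> (\<exists>c. ren (case_nat c f) p \<in> H)"
    unfolding case_nat_map Ex.IH ..
  finally show ?case by (simp only: sat.simps ren.simps Ex_H inst_ren_up)
next
  case (Eq i j)
  show ?case by (simp only: sat.simps ren.simps g)
next
  case (Imp p q)
  then show ?case by (simp only: sat.simps ren.simps Imp_H)
next
  case (And p q)
  then show ?case by (simp only: sat.simps ren.simps And_H)
next
  case (Or p q)
  then show ?case by (simp only: sat.simps ren.simps Or_H)
next
  case Fls
  show ?case by (simp only: sat.simps ren.simps Fls_H)
qed

text \<open>With infinitely many classes, \<open>to_nat_on\<close> enumerates them bijectively,
  which moves the model to the fixed carrier \<open>nat\<close>. Every assignment is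
  \<open>g\<close> after some renaming, and renamings do not affect closed formulae.\<close>

lemma (in henkin_set) closed_model:
  assumes "infinite (range (\<lambda>i. {j. Eq i j \<in> H}))"
  shows "\<exists>E :: nat \<Rightarrow> nat \<Rightarrow> bool. \<forall>p\<in>H. fv p = {} \<longrightarrow> (\<forall>e. sat E p e)"
proof -
  let ?C = "range (\<lambda>i. {j. Eq i j \<in> H})"
  define g where "g i = to_nat_on ?C {j. Eq i j \<in> H}" for i
  have bij: "bij_betw (to_nat_on ?C) ?C UNIV"
    using assms by (intro to_nat_on_infinite) auto
  have surj: "surj g"
    using bij_betw_imp_surj_on[OF bij] by (simp add: g_def image_image)
  have "g i = g j \<longleftrightarrow> {k. Eq i k \<in> H} = {k. Eq j k \<in> H}" for i j
    unfolding g_def using inj_on_eq_iff[OF bij_betw_imp_inj_on[OF bij]] by blast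
  moreover have "{k. Eq i k \<in> H} = {k. Eq j k \<in> H} \<longleftrightarrow> Eq i j \<in> H" for i j
    using Eq_refl_H[of j] Eq_sym_H[of i j] Eq_trans_H[of i j] Eq_trans_H[of j i] by blast
  ultimately have g: "g i = g j \<longleftrightarrow> Eq i j \<in> H" for i j by simp
  let ?E = "\<lambda>a b. \<exists>i j. g i = a \<and> g j = b \<and> Mem i j \<in> H"
  have "sat ?E p e" if "p \<in> H" "fv p = {}" for p e
  proof -
    have "e = (\<lambda>i. g (inv g (e i)))" using surj by (simp add: surj_f_inv_f)
    then show ?thesis
      using truth[OF surj g, of p "\<lambda>i. inv g (e i)"] that by (simp add: ren_closed)
  qed
  then show ?thesis by blast
qed

text \<open>In a finite model, pairing and union would produce an element that contains every
  element, hence itself; foundation for its singleton excludes this.\<close>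

lemma (in henkin_set) infinitely_many_classes:
  assumes "M \<subseteq> H"
  shows "infinite (range (\<lambda>i. {j. Eq i j \<in> H}))"
proof
  assume fin: "finite (range (\<lambda>i. {j. Eq i j \<in> H}))"
  note H_simps = All_H Ex_H And_H Or_H Imp_H inst_def up_def numeral_2_eq_2 numeral_3_eq_3
  have "Pairing \<in> H" using assms by (auto simp: M_def)
  then have pair: "\<exists>c. \<forall>x. Mem x c \<in> H \<longleftrightarrow> Eq x a \<in> H \<or> Eq x b \<in> H" for a b
    by (simp add: Pairing_def H_simps) blast
  have "Union_ax \<in> H" using assms by (auto simp: M_def)
  then have union: "\<exists>u. \<forall>x. Mem x u \<in> H \<longleftrightarrow> (\<exists>y. Mem y a \<in> H \<and> Mem x y \<in> H)" for a
    by (simp add: Union_ax_def H_simps) blast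
  have "(All ^^ 1) (Imp (Ex (Mem 0 1)) (Ex (And (Mem 0 1) (AllIn 0 (Neg (ren (up Suc) (Mem 0 1)))))))
      \<in> Foundation {Mem 0 1}"
    unfolding Foundation_def by (intro CollectI exI[of _ 1] exI[of _ "Mem 0 1"]) auto
  with assms have "All (Imp (Ex (Mem 0 1)) (Ex (And (Mem 0 1) (AllIn 0 (Neg (Mem 0 2)))))) \<in> H"
    by (auto simp: M_def numeral_2_eq_2)
  then have foundation: "\<exists>y. Mem y z \<in> H \<and> (\<forall>x. Mem x y \<in> H \<longrightarrow> Mem x z \<notin> H)"
    if "Mem x z \<in> H" for x z
    using that by (simp add: H_simps Fls_H) blast
  have ex_upper: "\<exists>u. \<forall>x\<in>F. Mem x u \<in> H" if "finite F" for F
    using that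
  proof (induction rule: finite_induct)
    case (insert a F)
    then obtain u where u: "\<forall>x\<in>F. Mem x u \<in> H" by blast
    \<comment> \<open>The new bound \<open>w\<close> is the union of a set with elements
      \<open>c\<close> and \<open>u\<close>, where \<open>c\<close> contains \<open>a\<close>; so it
      contains \<open>a\<close> and everything in \<open>u\<close>.\<close>
    obtain c where "Mem a c \<in> H" using pair[of a a] Eq_refl_H[of a] by blast
    moreover obtain d where "Mem c d \<in> H" "Mem u d \<in> H"
      using pair[of c u] Eq_refl_H[of c] Eq_refl_H[of u] by blast
    moreover obtain w where "\<forall>x. Mem x w \<in> H \<longleftrightarrow> (\<exists>y. Mem y d \<in> H \<and> Mem x y \<in> H)"
      using union[of d] by blast
    ultimately show ?case using u by (intro exI[of _ w]) auto
  qed auto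
  obtain F where F: "finite F"
    "range (\<lambda>i. {j. Eq i j \<in> H}) = (\<lambda>i. {j. Eq i j \<in> H}) ` F"
    using finite_subset_image[OF fin order_refl] by blast
  obtain u where u: "\<forall>x\<in>F. Mem x u \<in> H" using ex_upper[OF F(1)] by blast
  have "{j. Eq u j \<in> H} \<in> (\<lambda>i. {j. Eq i j \<in> H}) ` F" unfolding F(2)[symmetric] by (rule rangeI)
  then obtain v where v: "v \<in> F" "{j. Eq u j \<in> H} = {j. Eq v j \<in> H}" by blast
  \<comment> \<open>\<open>F\<close> represents every class, so some \<open>v\<close> in
    \<open>F\<close> is equal to \<open>u\<close>; as \<open>v\<close> is an element of
    \<open>u\<close>, so is \<open>u\<close> itself.\<close>
  then have "Eq v u \<in> H" using Eq_refl_H[of u] by blast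
  then have uu: "Mem u u \<in> H" using u v(1) Mem_cong_H[OF _ Eq_refl_H, of v u u] by simp
  obtain d where d: "\<forall>x. Mem x d \<in> H \<longleftrightarrow> Eq x u \<in> H" using pair[of u u] by blast
  then obtain y where y: "Mem y d \<in> H" "\<forall>x. Mem x y \<in> H \<longrightarrow> Mem x d \<notin> H"
    using foundation[of u d] Eq_refl_H[of u] by blast
  then have "Mem u y \<in> H" using d by (intro Mem_cong_H[OF Eq_refl_H Eq_sym_H uu]) simp
  with y d Eq_refl_H[of u] show False by blast
qed

section \<open>Closedness of the axioms and completeness for sentences\<close>

lemma fv_Alls: "fv p \<subseteq> {..<n} \<Longrightarrow> fv ((All ^^ n) p) = {}"
proof (induction n arbitrary: p)
  case (Suc n)
  have "fv (All p) \<subseteq> {..<n}" using Suc.prems by auto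
  then have "fv ((All ^^ n) (All p)) = {}" by (rule Suc.IH)
  then show ?case by (simp only: funpow_Suc_right comp_apply)
qed simp

lemma fv_Foundation: "p \<in> Foundation \<Gamma> \<Longrightarrow> fv p = {}"
proof -
  assume "p \<in> Foundation \<Gamma>"
  then obtain n q where p: "p = (All ^^ n) (Imp (Ex q) (Ex (And q (AllIn 0 (Neg (ren (up Suc) q))))))"
    and q: "fv q \<subseteq> {..<n + 1}" unfolding Foundation_def by blast
  have "fv (ren (up Suc) q) \<subseteq> {..<n + 2}"
    unfolding fv_ren using q by (auto simp: up_def split: nat.split)
  with q show ?thesis unfolding p by (intro fv_Alls) (auto simp: subset_iff)
qed

lemma fv_Separation: "p \<in> Separation \<Gamma> \<Longrightarrow> fv p = {}"
proof -
  assume "p \<in> Separation \<Gamma>"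
  then obtain n q where p: "p = (All ^^ n)
      (All (Ex (All (Iff (Mem 0 1) (And (Mem 0 2) (ren (up (\<lambda>i. i + 2)) q))))))"
    and q: "fv q \<subseteq> {..<n + 1}" unfolding Separation_def by blast
  have "fv (ren (up (\<lambda>i. i + 2)) q) \<subseteq> {..<n + 3}"
    unfolding fv_ren using q by (auto simp: up_def split: nat.split)
  with q show ?thesis unfolding p by (intro fv_Alls) (auto simp: subset_iff)
qed

lemma fv_Collection: "p \<in> Collection \<Gamma> \<Longrightarrow> fv p = {}"
proof -
  assume "p \<in> Collection \<Gamma>"
  then obtain n q where p: "p = (All ^^ n) (All (Imp
        (AllIn 0 (Ex (ren (up (up Suc)) q)))
        (Ex (AllIn 1 (ExIn 1 (ren (up (up (\<lambda>i. i + 2))) q))))))"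
    and q: "fv q \<subseteq> {..<n + 2}" unfolding Collection_def by blast
  have "fv (ren (up (up (\<lambda>i. i + 2))) q) \<subseteq> {..<n + 4}" "fv (ren (up (up Suc)) q) \<subseteq> {..<n + 3}"
    unfolding fv_ren using q by (auto simp: up_def split: nat.split)
  with q show ?thesis unfolding p by (intro fv_Alls) (auto simp: subset_iff)
qed

lemma fv_KPP: "p \<in> KPP \<Longrightarrow> fv p = {}"
  unfolding KPP_def M_def
  by (auto simp: fv_Foundation fv_Separation fv_Collection Extensionality_def Emptyset_def
      Pairing_def Union_ax_def Set_difference_def Powerset_def TCo_def Infinity_def)

theorem KPP_complete:
  assumes "fv p = {}"
    and models: "\<And>E :: nat \<Rightarrow> nat \<Rightarrow> bool. (\<And>q e. q \<in> KPP \<Longrightarrow> sat E q e) \<Longrightarrow> (\<And>e. sat E p e)"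
  shows "KPP \<turnstile> p"
proof (rule ccontr)
  assume "\<not> KPP \<turnstile> p"
  then have "\<not> insert (Neg p) KPP \<turnstile> Fls" using Class by blast
  moreover have closed: "fv q = {}" if "q \<in> insert (Neg p) KPP" for q
    using that assms(1) fv_KPP by auto
  then have "\<Union> (fv ` insert (Neg p) KPP) = {}" by blast
  ultimately obtain H where H: "insert (Neg p) KPP \<subseteq> H" "henkin_set H"
    using ex_henkin_set by (metis finite.emptyI)
  interpret henkin_set H by fact
  have "infinite (range (\<lambda>i. {j. Eq i j \<in> H}))"
    using H(1) by (intro infinitely_many_classes) (auto simp: KPP_def)
  then obtain E :: "nat \<Rightarrow> nat \<Rightarrow> bool" where E: "\<forall>q\<in>H. fv q = {} \<longrightarrow> (\<forall>e. sat E q e)"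
    using closed_model by blast
  have "sat E (Neg p) e" for e using E H(1) closed by blast
  moreover have "sat E p e" for e
  proof (rule models)
    show "sat E q e" if "q \<in> KPP" for q e using E H(1) closed that by blast
  qed
  ultimately show False by simp
qed

section \<open>Definable predicates\<close>

text \<open>Constant functions supply parameters from the model. With this semantic notion of term,
  definability of a predicate is proved by applying closure rules to its HOL text, without writing
  out formulae and indices.\<close>

definition tm :: "((nat \<Rightarrow> 'a) \<Rightarrow> 'a) \<Rightarrow> bool" where
  "tm t \<longleftrightarrow> (\<exists>i. t = (\<lambda>e. e i)) \<or> (\<exists>c. t = (\<lambda>e. c))"

lemma tm_intros: "tm (\<lambda>e. e i)" "tm (\<lambda>e. c)"
  by (auto simp: tm_def)

definition df :: "('a \<Rightarrow> 'a \<Rightarrow> bool) \<Rightarrow> fm set \<Rightarrow> ((nat \<Rightarrow> 'a) \<Rightarrow> bool) \<Rightarrow> bool" where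
  "df E \<Gamma> R \<longleftrightarrow> (\<exists>p\<in>\<Gamma>. \<exists>r. (\<forall>i. tm (r i)) \<and> (\<forall>e. R e \<longleftrightarrow> sat E p (\<lambda>i. r i e)))"

lemma dfE:
  assumes "df E \<Gamma> R"
  obtains p r where "p \<in> \<Gamma>" "\<And>i. tm (r i)" "\<And>e. R e \<longleftrightarrow> sat E p (\<lambda>i. r i e)"
  using assms unfolding df_def by blast

lemma dfI: "p \<in> \<Gamma> \<Longrightarrow> (\<And>i. tm (r i)) \<Longrightarrow> (\<And>e. R e \<longleftrightarrow> sat E p (\<lambda>i. r i e)) \<Longrightarrow> df E \<Gamma> R"
  unfolding df_def by blast

definition sub :: "('a \<Rightarrow> 'a \<Rightarrow> bool) \<Rightarrow> 'a \<Rightarrow> 'a \<Rightarrow> bool" where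
  "sub E x y \<longleftrightarrow> (\<forall>z. E z x \<longrightarrow> E z y)"

lemma case_nat_eta:
  fixes e :: "nat \<Rightarrow> 'a"
  shows "case_nat (e 0) (\<lambda>i. e (Suc i)) = e"
  by (rule ext) (simp split: nat.split)

lemma tm_case_nat: "tm t \<Longrightarrow> (\<And>i. tm (r i)) \<Longrightarrow> tm (case_nat t r i)"
  by (simp split: nat.split)

text \<open>Separates the innermost variable from the rest: indices whose term is that variable are
  renamed to 0, and the others receive terms that no longer depend on it.\<close>

lemma tm_bind:
  fixes r :: "nat \<Rightarrow> (nat \<Rightarrow> 'a) \<Rightarrow> 'a"
  assumes "\<And>i. tm (r i)"
  shows "\<exists>f r'. (\<forall>i. tm (r' i)) \<and>
    (\<forall>x e. (\<lambda>i. r i (case_nat x e)) = (\<lambda>i. case_nat x (\<lambda>j. r' j e) (f i)))"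
proof -
  define f where "f i = (if r i = (\<lambda>e. e 0) then 0 else Suc i)" for i
  \<comment> \<open>The value \<open>undefined\<close> stands in for the bound variable and is never
    read: where \<open>r i\<close> is that variable, \<open>f i\<close> is 0.\<close>
  define r' where "r' i = (\<lambda>e. r i (case_nat undefined e))" for i
  have *: "tm (r' i) \<and> r i (case_nat x e) = case_nat x (\<lambda>j. r' j e) (f i)" for i x e
    using assms[of i, unfolded tm_def]
  proof (elim disjE exE)
    fix k assume k: "r i = (\<lambda>e. e k)"
    show ?thesis
    proof (cases k)
      case 0
      then show ?thesis using k by (simp add: r'_def f_def tm_intros)
    next
      case (Suc m)
      show ?thesis
      \<comment> \<open>Different coordinates are the same function if the carrier has only one
        element, so the test in \<open>f\<close> may succeed here as well.\<close>
      proof (cases "r i = (\<lambda>e. e 0)")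
        case True
        then show ?thesis by (simp add: r'_def f_def tm_intros)
      next
        case False
        then show ?thesis using k Suc by (simp add: r'_def f_def tm_intros)
      qed
    qed
  next
    fix c assume "r i = (\<lambda>e. c)"
    then show ?thesis
      by (cases "r i = (\<lambda>e. e 0)") (use fun_cong[of "\<lambda>e. e 0" "\<lambda>e. c" "case_nat x e"] in
        \<open>simp_all add: r'_def f_def tm_intros\<close>)
  qed
  show ?thesis by (intro exI[of _ f] exI[of _ r']) (simp add: *)
qed

text \<open>Brings a definable predicate into the shape of the axiom schemes: a formula with its
  argument at index 0 and an assignment \<open>\<rho>\<close> that holds the parameters.\<close>

lemma df_unary:
  assumes "df E \<Gamma> (\<lambda>e. R (e 0))" and ren: "\<And>f p. p \<in> \<Gamma> \<Longrightarrow> ren f p \<in> \<Gamma>"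
  shows "\<exists>p\<in>\<Gamma>. \<exists>\<rho>. \<forall>x. R x \<longleftrightarrow> sat E p (case_nat x \<rho>)"
proof -
  obtain p r where "p \<in> \<Gamma> \<and> (\<forall>i. tm (r i)) \<and> (\<forall>e. R (e 0) \<longleftrightarrow> sat E p (\<lambda>i. r i e))"
    using assms(1) unfolding df_def by blast
  then have p: "p \<in> \<Gamma>" "\<And>i. tm (r i)" and R: "\<And>e. R (e 0) \<longleftrightarrow> sat E p (\<lambda>i. r i e)"
    by blast+
  obtain f r' where "(\<forall>i. tm (r' i)) \<and>
      (\<forall>x e. (\<lambda>i. r i (case_nat x e)) = (\<lambda>i. case_nat x (\<lambda>j. r' j e) (f i)))"
    using tm_bind[of r, OF p(2)] by blast
  then have tm': "\<And>i. tm (r' i)"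
    and r': "\<And>x e. (\<lambda>i. r i (case_nat x e)) = (\<lambda>i. case_nat x (\<lambda>j. r' j e) (f i))"
    by blast+
  show ?thesis
  proof (intro bexI[of _ "ren f p"] exI[of _ "\<lambda>j. r' j undefined"] allI)
    show "R x \<longleftrightarrow> sat E (ren f p) (case_nat x (\<lambda>j. r' j undefined))" for x
      using R[of "case_nat x undefined"] by (simp add: sat_ren r')
  qed (use p ren in blast)
qed

lemma df_binary:
  assumes "df E \<Gamma> (\<lambda>e. R (e 0) (e 1))" and ren: "\<And>f p. p \<in> \<Gamma> \<Longrightarrow> ren f p \<in> \<Gamma>"
  shows "\<exists>p\<in>\<Gamma>. \<exists>\<rho>. \<forall>x y. R x y \<longleftrightarrow> sat E p (case_nat x (case_nat y \<rho>))"
proof -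
  obtain p r where "p \<in> \<Gamma> \<and> (\<forall>i. tm (r i)) \<and> (\<forall>e. R (e 0) (e 1) \<longleftrightarrow> sat E p (\<lambda>i. r i e))"
    using assms(1) unfolding df_def by blast
  then have p: "p \<in> \<Gamma>" "\<And>i. tm (r i)" and R: "\<And>e. R (e 0) (e 1) \<longleftrightarrow> sat E p (\<lambda>i. r i e)"
    by blast+
  obtain f r' where "(\<forall>i. tm (r' i)) \<and>
      (\<forall>x e. (\<lambda>i. r i (case_nat x e)) = (\<lambda>i. case_nat x (\<lambda>j. r' j e) (f i)))"
    using tm_bind[of r, OF p(2)] by blast
  then have tm': "\<And>i. tm (r' i)"
    and r': "\<And>x e. (\<lambda>i. r i (case_nat x e)) = (\<lambda>i. case_nat x (\<lambda>j. r' j e) (f i))"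
    by blast+
  obtain f' r'' where "(\<forall>i. tm (r'' i)) \<and>
      (\<forall>x e. (\<lambda>i. r' i (case_nat x e)) = (\<lambda>i. case_nat x (\<lambda>j. r'' j e) (f' i)))"
    using tm_bind[of r', OF tm'] by blast
  then have tm'': "\<And>i. tm (r'' i)"
    and r'': "\<And>x e. (\<lambda>i. r' i (case_nat x e)) = (\<lambda>i. case_nat x (\<lambda>j. r'' j e) (f' i))"
    by blast+
  show ?thesis
  proof (intro bexI[of _ "ren (up f') (ren f p)"] exI[of _ "\<lambda>j. r'' j undefined"] allI)
    show "R x y \<longleftrightarrow> sat E (ren (up f') (ren f p)) (case_nat x (case_nat y (\<lambda>j. r'' j undefined)))"
      for x y
      using R[of "case_nat x (case_nat y undefined)"] by (simp add: sat_ren case_nat_up r' fun_cong[OF r''] cong: nat.case_cong)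
  qed (use p ren in blast)
qed

lemma df_subst:
  assumes "df E \<Gamma> R" "\<And>i. tm (s i)"
  shows "df E \<Gamma> (\<lambda>e. R (\<lambda>i. s i e))"
  using assms(1)
proof (rule dfE)
  fix p r assume p: "p \<in> \<Gamma>" "\<And>i. tm (r i)" "\<And>e. R e \<longleftrightarrow> sat E p (\<lambda>i. r i e)"
  show ?thesis
  proof (rule dfI[OF p(1), of "\<lambda>i e. r i (\<lambda>j. s j e)"])
    show "tm (\<lambda>e. r i (\<lambda>j. s j e))" for i
      using p(2)[of i] assms(2) unfolding tm_def[of "r i"] by (auto simp: tm_intros)
  qed (rule p(3))
qed

section \<open>Closure properties of definable predicates, uniformly for \<open>Delta0\<close> and
  \<open>Delta0P\<close>\<close>

locale formula_class =
  fixes \<Gamma> :: "fm set"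
  assumes Mem: "Mem i j \<in> \<Gamma>"
    and Eq: "Eq i j \<in> \<Gamma>"
    and Fls: "Fls \<in> \<Gamma>"
    and Imp: "p \<in> \<Gamma> \<Longrightarrow> q \<in> \<Gamma> \<Longrightarrow> Imp p q \<in> \<Gamma>"
    and And: "p \<in> \<Gamma> \<Longrightarrow> q \<in> \<Gamma> \<Longrightarrow> And p q \<in> \<Gamma>"
    and Or: "p \<in> \<Gamma> \<Longrightarrow> q \<in> \<Gamma> \<Longrightarrow> Or p q \<in> \<Gamma>"
    and AllIn: "p \<in> \<Gamma> \<Longrightarrow> AllIn y p \<in> \<Gamma>"
    and ExIn: "p \<in> \<Gamma> \<Longrightarrow> ExIn y p \<in> \<Gamma>"
    and ren: "p \<in> \<Gamma> \<Longrightarrow> ren f p \<in> \<Gamma>"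
begin

lemma df_mem: "tm t \<Longrightarrow> tm s \<Longrightarrow> df E \<Gamma> (\<lambda>e. E (t e) (s e))"
  by (rule dfI[OF Mem[of 0 1], of "case_nat t (\<lambda>_. s)"]) (auto intro: tm_case_nat)

lemma df_eq: "tm t \<Longrightarrow> tm s \<Longrightarrow> df E \<Gamma> (\<lambda>e. t e = s e)"
  by (rule dfI[OF Eq[of 0 1], of "case_nat t (\<lambda>_. s)"]) (auto intro: tm_case_nat)

text \<open>The two assignments are interleaved: even indices carry the terms of the first formula,
  odd ones those of the second.\<close>

lemma common_env:
  assumes "df E \<Gamma> R" "df E \<Gamma> S"
  obtains p q r where "p \<in> \<Gamma>" "q \<in> \<Gamma>" "\<And>i. tm (r i)"
    "\<And>e. R e \<longleftrightarrow> sat E p (\<lambda>i. r i e)" "\<And>e. S e \<longleftrightarrow> sat E q (\<lambda>i. r i e)"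
proof -
  obtain p r where "p \<in> \<Gamma> \<and> (\<forall>i. tm (r i)) \<and> (\<forall>e. R e \<longleftrightarrow> sat E p (\<lambda>i. r i e))"
    using assms(1) unfolding df_def by blast
  then have p: "p \<in> \<Gamma>" "\<And>i. tm (r i)" "\<And>e. R e \<longleftrightarrow> sat E p (\<lambda>i. r i e)"
    by blast+
  obtain q s where "q \<in> \<Gamma> \<and> (\<forall>i. tm (s i)) \<and> (\<forall>e. S e \<longleftrightarrow> sat E q (\<lambda>i. s i e))"
    using assms(2) unfolding df_def by blast
  then have q: "q \<in> \<Gamma>" "\<And>i. tm (s i)" "\<And>e. S e \<longleftrightarrow> sat E q (\<lambda>i. s i e)"
    by blast+
  show ?thesis
    by (rule that[of "ren (\<lambda>i. 2 * i) p" "ren (\<lambda>i. 2 * i + 1) q"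
          "\<lambda>i. if even i then r (i div 2) else s (i div 2)"])
      (use p q in \<open>simp_all add: ren sat_ren\<close>)
qed

lemma df_imp:
  assumes "df E \<Gamma> R" "df E \<Gamma> S"
  shows "df E \<Gamma> (\<lambda>e. R e \<longrightarrow> S e)"
proof (rule common_env[OF assms])
  fix p q r
  assume "p \<in> \<Gamma>" "q \<in> \<Gamma>" "\<And>i. tm (r i)"
    "\<And>e. R e \<longleftrightarrow> sat E p (\<lambda>i. r i e)" "\<And>e. S e \<longleftrightarrow> sat E q (\<lambda>i. r i e)"
  then show ?thesis by (intro dfI[of "Imp p q" \<Gamma> r]) (simp_all add: Imp)
qed

lemma df_and:
  assumes "df E \<Gamma> R" "df E \<Gamma> S"
  shows "df E \<Gamma> (\<lambda>e. R e \<and> S e)"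
proof (rule common_env[OF assms])
  fix p q r
  assume "p \<in> \<Gamma>" "q \<in> \<Gamma>" "\<And>i. tm (r i)"
    "\<And>e. R e \<longleftrightarrow> sat E p (\<lambda>i. r i e)" "\<And>e. S e \<longleftrightarrow> sat E q (\<lambda>i. r i e)"
  then show ?thesis by (intro dfI[of "And p q" \<Gamma> r]) (simp_all add: And)
qed

lemma df_or:
  assumes "df E \<Gamma> R" "df E \<Gamma> S"
  shows "df E \<Gamma> (\<lambda>e. R e \<or> S e)"
proof (rule common_env[OF assms])
  fix p q r
  assume "p \<in> \<Gamma>" "q \<in> \<Gamma>" "\<And>i. tm (r i)"
    "\<And>e. R e \<longleftrightarrow> sat E p (\<lambda>i. r i e)" "\<And>e. S e \<longleftrightarrow> sat E q (\<lambda>i. r i e)"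
  then show ?thesis by (intro dfI[of "Or p q" \<Gamma> r]) (simp_all add: Or)
qed

lemma df_false: "df E \<Gamma> (\<lambda>e. False)"
  by (rule dfI[OF Fls, of "\<lambda>i e. e i"]) (auto intro: tm_intros)

lemma df_not: "df E \<Gamma> R \<Longrightarrow> df E \<Gamma> (\<lambda>e. \<not> R e)"
  using df_imp[OF _ df_false] by simp

text \<open>Reserves index 0 of the outer assignment for the bounding term \<open>t\<close>. In this
  way \<open>t\<close> may be a parameter, although a bounded quantifier of the syntax needs a
  variable as its bound.\<close>

lemma quantifier_env:
  assumes "tm t" "df E \<Gamma> (\<lambda>e. R (e 0) (\<lambda>i. e (Suc i)))"
  obtains p r where "p \<in> \<Gamma>" "\<And>i. tm (r i)" "r 0 = t"
    "\<And>x e. R x e \<longleftrightarrow> sat E p (case_nat x (\<lambda>i. r i e))"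
proof -
  obtain p r where "p \<in> \<Gamma> \<and> (\<forall>i. tm (r i)) \<and> (\<forall>e. R (e 0) (\<lambda>i. e (Suc i)) \<longleftrightarrow> sat E p (\<lambda>i. r i e))"
    using assms(2) unfolding df_def by blast
  then have p: "p \<in> \<Gamma>" "\<And>i. tm (r i)" and R: "\<And>e. R (e 0) (\<lambda>i. e (Suc i)) \<longleftrightarrow> sat E p (\<lambda>i. r i e)"
    by blast+
  obtain f r' where "(\<forall>i. tm (r' i)) \<and>
      (\<forall>x e. (\<lambda>i. r i (case_nat x e)) = (\<lambda>i. case_nat x (\<lambda>j. r' j e) (f i)))"
    using tm_bind[of r, OF p(2)] by blast
  then have tm': "\<And>i. tm (r' i)"
    and r': "\<And>x e. (\<lambda>i. r i (case_nat x e)) = (\<lambda>i. case_nat x (\<lambda>j. r' j e) (f i))"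
    by blast+
  show ?thesis
  proof (rule that[of "ren (up Suc) (ren f p)" "case_nat t r'"])
    show "R x e \<longleftrightarrow> sat E (ren (up Suc) (ren f p)) (case_nat x (\<lambda>i. case_nat t r' i e))" for x e
      using R[of "case_nat x e"] by (simp add: sat_ren case_nat_up r')
  qed (use p tm' assms(1) in \<open>auto intro: ren tm_case_nat\<close>)
qed

lemma df_all:
  assumes "tm t" "df E \<Gamma> (\<lambda>e. R (e 0) (\<lambda>i. e (Suc i)))"
  shows "df E \<Gamma> (\<lambda>e. \<forall>x. E x (t e) \<longrightarrow> R x e)"
proof (rule quantifier_env[OF assms])
  fix p r
  assume "p \<in> \<Gamma>" "\<And>i. tm (r i)" "r 0 = t"
    "\<And>x e. R x e \<longleftrightarrow> sat E p (case_nat x (\<lambda>i. r i e))"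
  then show ?thesis by (intro dfI[of "AllIn 0 p" \<Gamma> r]) (simp_all add: AllIn)
qed

lemma df_ex:
  assumes "tm t" "df E \<Gamma> (\<lambda>e. R (e 0) (\<lambda>i. e (Suc i)))"
  shows "df E \<Gamma> (\<lambda>e. \<exists>x. E x (t e) \<and> R x e)"
proof (rule quantifier_env[OF assms])
  fix p r
  assume "p \<in> \<Gamma>" "\<And>i. tm (r i)" "r 0 = t"
    "\<And>x e. R x e \<longleftrightarrow> sat E p (case_nat x (\<lambda>i. r i e))"
  then show ?thesis by (intro dfI[of "ExIn 0 p" \<Gamma> r]) (simp_all add: ExIn)
qed

lemma tm_shift: "tm t \<Longrightarrow> tm (\<lambda>e. t (\<lambda>i. e (Suc i)))"
  by (auto simp: tm_def)

lemma df_sub: "tm t \<Longrightarrow> tm s \<Longrightarrow> df E \<Gamma> (\<lambda>e. sub E (t e) (s e))"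
  unfolding sub_def
  by (intro df_all df_mem tm_intros tm_shift)

end

global_interpretation Delta0: formula_class Delta0
proof
  show "ren f p \<in> Delta0" if "p \<in> Delta0" for f p
    using that by (induction arbitrary: f) (auto intro: Delta0.intros)
qed (auto intro: Delta0.intros)

global_interpretation Delta0P: formula_class Delta0P
proof
  show "ren f p \<in> Delta0P" if "p \<in> Delta0P" for f p
    using that by (induction arbitrary: f) (auto intro: Delta0P.intros)
qed (auto intro: Delta0P.intros)

lemma df_allsub:
  assumes "tm t" "df E Delta0P (\<lambda>e. R (e 0) (\<lambda>i. e (Suc i)))"
  shows "df E Delta0P (\<lambda>e. \<forall>x. sub E x (t e) \<longrightarrow> R x e)"
proof (rule Delta0P.quantifier_env[OF assms])
  fix p r
  assume "p \<in> Delta0P" "\<And>i. tm (r i)" "r 0 = t"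
    "\<And>x e. R x e \<longleftrightarrow> sat E p (case_nat x (\<lambda>i. r i e))"
  then show ?thesis
    by (intro dfI[of "AllSub 0 p" Delta0P r]) (simp_all add: Delta0P.intros sub_def)
qed

lemma df_exsub:
  assumes "tm t" "df E Delta0P (\<lambda>e. R (e 0) (\<lambda>i. e (Suc i)))"
  shows "df E Delta0P (\<lambda>e. \<exists>x. sub E x (t e) \<and> R x e)"
proof (rule Delta0P.quantifier_env[OF assms])
  fix p r
  assume "p \<in> Delta0P" "\<And>i. tm (r i)" "r 0 = t"
    "\<And>x e. R x e \<longleftrightarrow> sat E p (case_nat x (\<lambda>i. r i e))"
  then show ?thesis
    by (intro dfI[of "ExSub 0 p" Delta0P r]) (simp_all add: Delta0P.intros sub_def)
qed

lemmas df_intros =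
  Delta0P.df_mem Delta0P.df_eq Delta0P.df_imp Delta0P.df_and Delta0P.df_or Delta0P.df_false
  Delta0P.df_not Delta0P.df_all Delta0P.df_ex Delta0P.df_sub df_allsub df_exsub
  tm_intros

text \<open>Lets definability of a defined notion be proved once for variables and then used for
  arbitrary terms.\<close>

lemma df_lift1:
  assumes "df E \<Gamma> (\<lambda>e. R (e 0))" "tm t"
  shows "df E \<Gamma> (\<lambda>e. R (t e))"
  using df_subst[OF assms(1), of "case_nat t (\<lambda>_. t)"] assms(2) by (simp add: tm_case_nat)

lemma df_lift2:
  assumes "df E \<Gamma> (\<lambda>e. R (e 0) (e 1))" "tm t" "tm u"
  shows "df E \<Gamma> (\<lambda>e. R (t e) (u e))"
  using df_subst[OF assms(1), of "case_nat t (\<lambda>_. u)"] assms(2,3) by (simp add: tm_case_nat)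

lemma df_lift3:
  assumes "df E \<Gamma> (\<lambda>e. R (e 0) (e 1) (e 2))" "tm t" "tm u" "tm v"
  shows "df E \<Gamma> (\<lambda>e. R (t e) (u e) (v e))"
  using df_subst[OF assms(1), of "case_nat t (case_nat u (\<lambda>_. v))"] assms(2-4)
  by (simp add: tm_case_nat)


section \<open>Set theory in a model\<close>

lemma sat_Alls: "(\<forall>e. sat E ((All ^^ n) p) e) \<longleftrightarrow> (\<forall>e. sat E p e)"
proof (induction n arbitrary: p)
  case (Suc n)
  have "(\<forall>e. sat E (All p) e) \<longleftrightarrow> (\<forall>e. sat E p e)"
    by (metis sat.simps(7) case_nat_eta)
  with Suc[of "All p"] show ?case by (simp only: funpow_Suc_right comp_apply)
qed simp

lemma fv_bound: "\<exists>n. fv p \<subseteq> {..<n}"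
  using finite_nat_bounded[OF finite_fv[of p]] by blast

locale kpp =
  fixes E :: "'a \<Rightarrow> 'a \<Rightarrow> bool"  (infix "\<epsilon>" 50)
  assumes kpp: "p \<in> KPP \<Longrightarrow> sat E p e"
begin

abbreviation dp :: "((nat \<Rightarrow> 'a) \<Rightarrow> bool) \<Rightarrow> bool" where
  "dp \<equiv> df E Delta0P"

abbreviation subset_of :: "'a \<Rightarrow> 'a \<Rightarrow> bool"  (infix "\<sqsubseteq>" 50) where
  "x \<sqsubseteq> y \<equiv> sub E x y"

lemma extensionality: "(\<And>z. z \<epsilon> x \<longleftrightarrow> z \<epsilon> y) \<Longrightarrow> x = y"
  using kpp[of Extensionality] by (simp add: KPP_def M_def Extensionality_def Let_def)

lemma ex_pair: "\<exists>c. \<forall>x. x \<epsilon> c \<longleftrightarrow> x = a \<or> x = b"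
  using kpp[of Pairing] by (simp add: KPP_def M_def Pairing_def iff_conv_conj_imp Let_def)

lemma ex_union: "\<exists>u. \<forall>x. x \<epsilon> u \<longleftrightarrow> (\<exists>y. y \<epsilon> a \<and> x \<epsilon> y)"
  using kpp[of Union_ax] by (simp add: KPP_def M_def Union_ax_def iff_conv_conj_imp Let_def)

lemma ex_power: "\<exists>u. \<forall>x. x \<epsilon> u \<longleftrightarrow> x \<sqsubseteq> a"
  using kpp[of Powerset] by (simp add: KPP_def M_def Powerset_def iff_conv_conj_imp Let_def sub_def)

lemma ex_transitive: "\<exists>t. a \<sqsubseteq> t \<and> (\<forall>y. y \<epsilon> t \<longrightarrow> y \<sqsubseteq> t)"
  using kpp[of TCo] by (simp add: KPP_def M_def TCo_def iff_conv_conj_imp Let_def sub_def)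

lemma ex_infinite:
  "\<exists>w. (\<exists>z. z \<epsilon> w \<and> (\<forall>x. \<not> x \<epsilon> z)) \<and>
     (\<forall>y. y \<epsilon> w \<longrightarrow> (\<exists>s. s \<epsilon> w \<and> (\<forall>x. x \<epsilon> s \<longleftrightarrow> x \<epsilon> y \<or> x = y)))"
  using kpp[of Infinity] by (simp add: KPP_def M_def Infinity_def iff_conv_conj_imp Let_def)

lemma separation_Delta0:
  assumes "df E Delta0 (\<lambda>e. R (e 0))"
  shows "\<exists>y. \<forall>x. x \<epsilon> y \<longleftrightarrow> x \<epsilon> w \<and> R x"
proof -
  obtain p \<rho> where p: "p \<in> Delta0" and R: "\<forall>x. R x \<longleftrightarrow> sat E p (case_nat x \<rho>)"
    using df_unary[OF assms Delta0.ren] by blast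
  obtain n where n: "fv p \<subseteq> {..<n}" using fv_bound by blast
  let ?q = "All (Ex (All (Iff (Mem 0 1) (And (Mem 0 2) (ren (up (\<lambda>i. i + 2)) p)))))"
  have "(All ^^ n) ?q \<in> Separation Delta0"
    unfolding Separation_def
    by (intro CollectI exI[of _ n] exI[of _ p]) (use p n in auto)
  then have "sat E ((All ^^ n) ?q) e" for e by (intro kpp) (simp add: KPP_def M_def)
  then have "sat E ?q \<rho>" using sat_Alls by blast
  then show ?thesis using R by (simp add: sat_ren case_nat_up Let_def) blast
qed

lemma collection:
  assumes "dp (\<lambda>e. R (e 0) (e 1))" "\<And>x. x \<epsilon> w \<Longrightarrow> \<exists>y. R y x"
  shows "\<exists>C. \<forall>x. x \<epsilon> w \<longrightarrow> (\<exists>y. y \<epsilon> C \<and> R y x)"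
proof -
  obtain p \<rho> where p: "p \<in> Delta0P"
    and R: "\<forall>y x. R y x \<longleftrightarrow> sat E p (case_nat y (case_nat x \<rho>))"
    using df_binary[OF assms(1) Delta0P.ren] by blast
  obtain n where n: "fv p \<subseteq> {..<n}" using fv_bound by blast
  let ?q = "All (Imp (AllIn 0 (Ex (ren (up (up Suc)) p)))
        (Ex (AllIn 1 (ExIn 1 (ren (up (up (\<lambda>i. i + 2))) p)))))"
  have "(All ^^ n) ?q \<in> Collection Delta0P"
    unfolding Collection_def
    by (intro CollectI exI[of _ n] exI[of _ p]) (use p n in auto)
  then have "sat E ((All ^^ n) ?q) e" for e by (intro kpp) (simp add: KPP_def)
  then have "sat E ?q \<rho>" using sat_Alls by blast
  then show ?thesis using R assms(2) by (simp add: sat_ren case_nat_up Let_def)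
qed

lemma foundation_Pi1P:
  assumes "q \<in> Pi1P" "sat E q (case_nat x \<rho>)"
  shows "\<exists>x. sat E q (case_nat x \<rho>) \<and> (\<forall>z. z \<epsilon> x \<longrightarrow> \<not> sat E q (case_nat z \<rho>))"
proof -
  obtain n where n: "fv q \<subseteq> {..<n}" using fv_bound by blast
  let ?q = "Imp (Ex q) (Ex (And q (AllIn 0 (Neg (ren (up Suc) q)))))"
  have "(All ^^ n) ?q \<in> Foundation Pi1P"
    unfolding Foundation_def
    by (intro CollectI exI[of _ n] exI[of _ q]) (use assms(1) n in auto)
  then have "sat E ((All ^^ n) ?q) e" for e by (intro kpp) (simp add: KPP_def)
  then have "sat E ?q \<rho>" using sat_Alls by blast
  then show ?thesis using assms(2) by (auto simp add: sat_ren case_nat_up)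
qed

lemma foundation:
  assumes "dp (\<lambda>e. R (e 0))" "R x"
  shows "\<exists>x. R x \<and> (\<forall>z. z \<epsilon> x \<longrightarrow> \<not> R z)"
proof -
  obtain p \<rho> where "p \<in> Delta0P" and R: "\<forall>x. R x \<longleftrightarrow> sat E p (case_nat x \<rho>)"
    using df_unary[OF assms(1) Delta0P.ren] by blast
  then show ?thesis using foundation_Pi1P[OF Pi1P.intros(1), of p x \<rho>] assms(2) by simp
qed

lemma mem_induct:
  assumes "dp (\<lambda>e. R (e 0))" "\<And>x. (\<And>z. z \<epsilon> x \<Longrightarrow> R z) \<Longrightarrow> R x"
  shows "R x"
  using foundation[OF Delta0P.df_not[OF assms(1)], of x] assms(2) by blast

lemma Sigma1P_induct:
  assumes "dp (\<lambda>e. R (e 0) (e 1))"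
    and step: "\<And>x. (\<And>z. z \<epsilon> x \<Longrightarrow> \<exists>y. R y z) \<Longrightarrow> \<exists>y. R y x"
  shows "\<exists>y. R y x"
proof (rule ccontr)
  assume "\<nexists>y. R y x"
  obtain p \<rho> where p: "p \<in> Delta0P"
    and R: "\<forall>y x. R y x \<longleftrightarrow> sat E p (case_nat y (case_nat x \<rho>))"
    using df_binary[OF assms(1) Delta0P.ren] by blast
  let ?q = "All (Neg p)"
  have q: "sat E ?q (case_nat x \<rho>) \<longleftrightarrow> (\<nexists>y. R y x)" for x using R by simp
  have "?q \<in> Pi1P" using p by (intro Pi1P.intros Delta0P.intros)
  then obtain x where "\<nexists>y. R y x" "\<forall>z. z \<epsilon> x \<longrightarrow> (\<exists>y. R y z)"
    using foundation_Pi1P[of ?q x \<rho>] \<open>\<nexists>y. R y x\<close> unfolding q by blast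
  then show False using step by blast
qed

lemma ex_un: "\<exists>u. \<forall>x. x \<epsilon> u \<longleftrightarrow> x \<epsilon> a \<or> x \<epsilon> b"
proof -
  obtain c where c: "\<forall>x. x \<epsilon> c \<longleftrightarrow> x = a \<or> x = b" using ex_pair by blast
  obtain u where "\<forall>x. x \<epsilon> u \<longleftrightarrow> (\<exists>y. y \<epsilon> c \<and> x \<epsilon> y)" using ex_union by blast
  with c show ?thesis by (intro exI[of _ u]) auto
qed

lemma ex_insert: "\<exists>u. \<forall>x. x \<epsilon> u \<longleftrightarrow> x \<epsilon> a \<or> x = b"
proof -
  obtain c where c: "\<forall>x. x \<epsilon> c \<longleftrightarrow> x = b \<or> x = b" using ex_pair by blast
  obtain u where "\<forall>x. x \<epsilon> u \<longleftrightarrow> x \<epsilon> a \<or> x \<epsilon> c" using ex_un by blast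
  with c show ?thesis by (intro exI[of _ u]) auto
qed

lemma ex_finite_superset: "finite F \<Longrightarrow> \<exists>u. w \<sqsubseteq> u \<and> (\<forall>x\<in>F. x \<epsilon> u)"
proof (induction rule: finite_induct)
  case empty
  show ?case by (intro exI[of _ w]) (simp add: sub_def)
next
  case (insert a F)
  then obtain u where u: "w \<sqsubseteq> u" "\<forall>x\<in>F. x \<epsilon> u" by blast
  obtain u' where "\<forall>x. x \<epsilon> u' \<longleftrightarrow> x \<epsilon> u \<or> x = a" using ex_insert by blast
  with u show ?case by (intro exI[of _ u']) (simp add: sub_def)
qed

lemma ex_union_closure: "\<exists>u. T \<sqsubseteq> u \<and> (\<forall>x y. x \<epsilon> y \<longrightarrow> y \<epsilon> T \<longrightarrow> x \<epsilon> u)"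
proof -
  obtain v where "\<forall>x. x \<epsilon> v \<longleftrightarrow> (\<exists>y. y \<epsilon> T \<and> x \<epsilon> y)" using ex_union by blast
  moreover obtain u where "\<forall>x. x \<epsilon> u \<longleftrightarrow> x \<epsilon> T \<or> x \<epsilon> v" using ex_un by blast
  ultimately show ?thesis by (intro exI[of _ u]) (auto simp: sub_def)
qed

text \<open>A subset of an element of \<open>T\<close> is a subset of the union of \<open>T\<close>,
  so \<open>T\<close> together with the power set of that union suffices.\<close>

lemma ex_subset_closure: "\<exists>u. T \<sqsubseteq> u \<and> (\<forall>x y. x \<sqsubseteq> y \<longrightarrow> y \<epsilon> T \<longrightarrow> x \<epsilon> u)"
proof -
  obtain v where "\<forall>x. x \<epsilon> v \<longleftrightarrow> (\<exists>y. y \<epsilon> T \<and> x \<epsilon> y)" using ex_union by blast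
  moreover obtain p where "\<forall>x. x \<epsilon> p \<longleftrightarrow> x \<sqsubseteq> v" using ex_power by blast
  moreover obtain u where "\<forall>x. x \<epsilon> u \<longleftrightarrow> x \<epsilon> T \<or> x \<epsilon> p" using ex_un by blast
  ultimately show ?thesis by (intro exI[of _ u]) (auto simp: sub_def)
qed

section \<open>Separation for \<open>Delta0P\<close> formulae\<close>

lemma env_closed:
  "(\<And>i. Suc i \<in> fv p \<Longrightarrow> e i \<epsilon> U) \<Longrightarrow> x \<epsilon> U \<Longrightarrow> \<forall>i\<in>fv p. case_nat x e i \<epsilon> U"
  by (auto split: nat.split)

text \<open>With all free variables ranging over one set \<open>T\<close>, every quantifier of a
  \<open>Delta0P\<close> formula can be bounded by a parameter obtained from \<open>T\<close> by finitely many unions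
  and power sets. Hence \<open>Delta0\<close>-separation suffices for \<open>Delta0P\<close>-separation.\<close>

lemma Delta0P_bounded:
  assumes "p \<in> Delta0P"
  shows "\<exists>R. df E Delta0 R \<and> (\<forall>e. (\<forall>i\<in>fv p. e i \<epsilon> T) \<longrightarrow> (sat E p e \<longleftrightarrow> R e))"
  using assms
proof (induction arbitrary: T)
  case (1 i j)
  show ?case
    by (intro exI[of _ "\<lambda>e. e i \<epsilon> e j"] conjI Delta0.df_mem tm_intros) simp
next
  case (2 i j)
  show ?case
    by (intro exI[of _ "\<lambda>e. e i = e j"] conjI Delta0.df_eq tm_intros) simp
next
  case 3
  show ?case by (intro exI[of _ "\<lambda>e. False"] conjI Delta0.df_false) simp
next
  case (4 p q)
  obtain R S where "df E Delta0 R" "\<forall>e. (\<forall>i\<in>fv p. e i \<epsilon> T) \<longrightarrow> (sat E p e \<longleftrightarrow> R e)"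
    "df E Delta0 S" "\<forall>e. (\<forall>i\<in>fv q. e i \<epsilon> T) \<longrightarrow> (sat E q e \<longleftrightarrow> S e)"
    using "4.IH"[of T] by blast
  then show ?case by (intro exI[of _ "\<lambda>e. R e \<longrightarrow> S e"] conjI Delta0.df_imp) simp_all
next
  case (5 p q)
  obtain R S where "df E Delta0 R" "\<forall>e. (\<forall>i\<in>fv p. e i \<epsilon> T) \<longrightarrow> (sat E p e \<longleftrightarrow> R e)"
    "df E Delta0 S" "\<forall>e. (\<forall>i\<in>fv q. e i \<epsilon> T) \<longrightarrow> (sat E q e \<longleftrightarrow> S e)"
    using "5.IH"[of T] by blast
  then show ?case by (intro exI[of _ "\<lambda>e. R e \<and> S e"] conjI Delta0.df_and) simp_all
next
  case (6 p q)
  obtain R S where "df E Delta0 R" "\<forall>e. (\<forall>i\<in>fv p. e i \<epsilon> T) \<longrightarrow> (sat E p e \<longleftrightarrow> R e)"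
    "df E Delta0 S" "\<forall>e. (\<forall>i\<in>fv q. e i \<epsilon> T) \<longrightarrow> (sat E q e \<longleftrightarrow> S e)"
    using "6.IH"[of T] by blast
  then show ?case by (intro exI[of _ "\<lambda>e. R e \<or> S e"] conjI Delta0.df_or) simp_all
next
  case (7 p y)
  obtain U where U: "T \<sqsubseteq> U" "\<forall>x y. x \<epsilon> y \<longrightarrow> y \<epsilon> T \<longrightarrow> x \<epsilon> U" using ex_union_closure by blast
  obtain R where R: "df E Delta0 R" "\<forall>e. (\<forall>i\<in>fv p. e i \<epsilon> U) \<longrightarrow> (sat E p e \<longleftrightarrow> R e)"
    using "7.IH" by blast
  have "sat E p (case_nat x e) \<longleftrightarrow> R (case_nat x e)"
    if "\<forall>i\<in>fv (AllIn y p). e i \<epsilon> T" "x \<epsilon> e y" for x e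
  proof -
    have "\<forall>i\<in>fv p. case_nat x e i \<epsilon> U"
      by (rule env_closed) (use that U in \<open>simp_all add: sub_def[of _ T]\<close>)
    with R(2) show ?thesis by blast
  qed
  then show ?case
    by (intro exI[of _ "\<lambda>e. \<forall>x. x \<epsilon> e y \<longrightarrow> R (case_nat x e)"] conjI Delta0.df_all tm_intros)
      (auto simp: case_nat_eta R(1))
next
  case (8 p y)
  obtain U where U: "T \<sqsubseteq> U" "\<forall>x y. x \<epsilon> y \<longrightarrow> y \<epsilon> T \<longrightarrow> x \<epsilon> U" using ex_union_closure by blast
  obtain R where R: "df E Delta0 R" "\<forall>e. (\<forall>i\<in>fv p. e i \<epsilon> U) \<longrightarrow> (sat E p e \<longleftrightarrow> R e)"
    using "8.IH" by blast
  have "sat E p (case_nat x e) \<longleftrightarrow> R (case_nat x e)"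
    if "\<forall>i\<in>fv (ExIn y p). e i \<epsilon> T" "x \<epsilon> e y" for x e
  proof -
    have "\<forall>i\<in>fv p. case_nat x e i \<epsilon> U"
      by (rule env_closed) (use that U in \<open>simp_all add: sub_def[of _ T]\<close>)
    with R(2) show ?thesis by blast
  qed
  then show ?case
    by (intro exI[of _ "\<lambda>e. \<exists>x. x \<epsilon> e y \<and> R (case_nat x e)"] conjI Delta0.df_ex tm_intros)
      (auto simp: case_nat_eta R(1))
next
  case (9 p y)
  \<comment> \<open>For subset quantifiers the range of \<open>x\<close> is cut down to the
    parameter \<open>U\<close>, and \<open>x \<sqsubseteq> e y\<close> survives as a
    \<open>Delta0\<close> side condition.\<close>
  obtain U where U: "T \<sqsubseteq> U" "\<forall>x y. x \<sqsubseteq> y \<longrightarrow> y \<epsilon> T \<longrightarrow> x \<epsilon> U" using ex_subset_closure by blast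
  obtain R where R: "df E Delta0 R" "\<forall>e. (\<forall>i\<in>fv p. e i \<epsilon> U) \<longrightarrow> (sat E p e \<longleftrightarrow> R e)"
    using "9.IH" by blast
  have "sat E p (case_nat x e) \<longleftrightarrow> R (case_nat x e)"
    if "\<forall>i\<in>fv (AllSub y p). e i \<epsilon> T" "x \<sqsubseteq> e y" for x e
  proof -
    have "\<forall>i\<in>fv p. case_nat x e i \<epsilon> U"
      by (rule env_closed) (use that U in \<open>simp_all add: sub_def[of _ T]\<close>)
    with R(2) show ?thesis by blast
  qed
  moreover have "x \<epsilon> U" if "\<forall>i\<in>fv (AllSub y p). e i \<epsilon> T" "x \<sqsubseteq> e y" for x e
    using that U(2) by auto
  ultimately have "sat E (AllSub y p) e \<longleftrightarrow> (\<forall>x. x \<epsilon> U \<longrightarrow> (x \<sqsubseteq> e y \<longrightarrow> R (case_nat x e)))"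
    if "\<forall>i\<in>fv (AllSub y p). e i \<epsilon> T" for e
    using that unfolding sat.simps by (simp add: sub_def) blast
  then show ?case
    by (intro exI[of _ "\<lambda>e. \<forall>x. x \<epsilon> U \<longrightarrow> (x \<sqsubseteq> e y \<longrightarrow> R (case_nat x e))"] conjI
        Delta0.df_all Delta0.df_imp Delta0.df_sub tm_intros)
      (auto simp: case_nat_eta R(1))
next
  case (10 p y)
  obtain U where U: "T \<sqsubseteq> U" "\<forall>x y. x \<sqsubseteq> y \<longrightarrow> y \<epsilon> T \<longrightarrow> x \<epsilon> U" using ex_subset_closure by blast
  obtain R where R: "df E Delta0 R" "\<forall>e. (\<forall>i\<in>fv p. e i \<epsilon> U) \<longrightarrow> (sat E p e \<longleftrightarrow> R e)"
    using "10.IH" by blast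
  have "sat E p (case_nat x e) \<longleftrightarrow> R (case_nat x e)"
    if "\<forall>i\<in>fv (ExSub y p). e i \<epsilon> T" "x \<sqsubseteq> e y" for x e
  proof -
    have "\<forall>i\<in>fv p. case_nat x e i \<epsilon> U"
      by (rule env_closed) (use that U in \<open>simp_all add: sub_def[of _ T]\<close>)
    with R(2) show ?thesis by blast
  qed
  moreover have "x \<epsilon> U" if "\<forall>i\<in>fv (ExSub y p). e i \<epsilon> T" "x \<sqsubseteq> e y" for x e
    using that U(2) by auto
  ultimately have "sat E (ExSub y p) e \<longleftrightarrow> (\<exists>x. x \<epsilon> U \<and> (x \<sqsubseteq> e y \<and> R (case_nat x e)))"
    if "\<forall>i\<in>fv (ExSub y p). e i \<epsilon> T" for e
    using that unfolding sat.simps by (simp add: sub_def) blast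
  then show ?case
    by (intro exI[of _ "\<lambda>e. \<exists>x. x \<epsilon> U \<and> (x \<sqsubseteq> e y \<and> R (case_nat x e))"] conjI
        Delta0.df_ex Delta0.df_and Delta0.df_sub tm_intros)
      (auto simp: case_nat_eta R(1))
qed

text \<open>A formula has finitely many free variables, so one set \<open>T\<close> contains all
  parameter values and every element of \<open>w\<close>. Relative to \<open>T\<close> the formula
  agrees with a \<open>Delta0\<close> predicate.\<close>

lemma separation:
  assumes "dp (\<lambda>e. R (e 0))"
  shows "\<exists>y. \<forall>x. x \<epsilon> y \<longleftrightarrow> x \<epsilon> w \<and> R x"
proof -
  obtain p \<rho> where p: "p \<in> Delta0P" and R: "\<forall>x. R x \<longleftrightarrow> sat E p (case_nat x \<rho>)"
    using df_unary[OF assms Delta0P.ren] by blast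
  have "finite (\<rho> ` {i. Suc i \<in> fv p})"
    using finite_fv[of "All p"] by simp
  then obtain T where T: "w \<sqsubseteq> T" "\<forall>x \<in> \<rho> ` {i. Suc i \<in> fv p}. x \<epsilon> T"
    using ex_finite_superset by blast
  obtain S where S: "df E Delta0 S" "\<forall>e. (\<forall>i\<in>fv p. e i \<epsilon> T) \<longrightarrow> (sat E p e \<longleftrightarrow> S e)"
    using Delta0P_bounded[OF p] by blast
  have *: "R x \<longleftrightarrow> S (case_nat x \<rho>)" if "x \<epsilon> w" for x
  proof -
    have "\<forall>i\<in>fv p. case_nat x \<rho> i \<epsilon> T" using that T by (auto simp: sub_def split: nat.split)
    with S(2) R show ?thesis by simp
  qed
  have "df E Delta0 (\<lambda>e. S (\<lambda>i. case_nat (\<lambda>e. e 0) (\<lambda>i e. \<rho> i) i e))"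
    by (rule df_subst[OF S(1)]) (auto intro: tm_case_nat tm_intros)
  moreover have "(\<lambda>i. case_nat (\<lambda>e. e 0) (\<lambda>i e. \<rho> i) i e) = case_nat (e 0) \<rho>" for e :: "nat \<Rightarrow> 'a"
    by (rule ext) (simp split: nat.split)
  ultimately have "df E Delta0 (\<lambda>e. S (case_nat (e 0) \<rho>))" by simp
  then have "\<exists>y. \<forall>x. x \<epsilon> y \<longleftrightarrow> x \<epsilon> w \<and> S (case_nat x \<rho>)"
    by (rule separation_Delta0)
  with * show ?thesis by blast
qed

definition trans_set :: "'a \<Rightarrow> bool" where
  "trans_set t \<longleftrightarrow> (\<forall>y. y \<epsilon> t \<longrightarrow> y \<sqsubseteq> t)"

lemma df_trans_set: "tm t \<Longrightarrow> dp (\<lambda>e. trans_set (t e))"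
  by (rule df_lift1) (unfold trans_set_def, intro df_intros)

lemma trans_setD: "trans_set t \<Longrightarrow> x \<epsilon> y \<Longrightarrow> y \<epsilon> t \<Longrightarrow> x \<epsilon> t"
  by (auto simp: trans_set_def sub_def)

lemma subD: "x \<sqsubseteq> y \<Longrightarrow> z \<epsilon> x \<Longrightarrow> z \<epsilon> y"
  by (simp add: sub_def)

lemma sub_refl: "x \<sqsubseteq> x"
  by (simp add: sub_def)

lemma sub_trans: "x \<sqsubseteq> y \<Longrightarrow> y \<sqsubseteq> z \<Longrightarrow> x \<sqsubseteq> z"
  by (simp add: sub_def)

lemma mem_irrefl: "\<not> x \<epsilon> x"
proof (rule mem_induct[where R = "\<lambda>x. \<not> x \<epsilon> x"])
  show "dp (\<lambda>e. \<not> e 0 \<epsilon> e 0)" by (intro df_intros)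
qed blast


subsection \<open>Levels of the cumulative hierarchy\<close>

text \<open>The Scott--Potter description of the sets \<open>V\<^sub>\<alpha>\<close>, which needs neither ordinals nor
  recursion: \<open>pot h s\<close> says that \<open>s\<close> is the union of the power sets of the elements of \<open>h\<close>,
  and \<open>h\<close> is a history if each \<open>x \<epsilon> h\<close> arises in this way from \<open>x \<inter> h\<close>. Since the history of a
  level is a subset of it, being a level is a \<open>Delta0P\<close> property.\<close>

definition pot :: "'a \<Rightarrow> 'a \<Rightarrow> bool" where
  "pot h s \<longleftrightarrow> (\<forall>x. x \<epsilon> s \<longrightarrow> (\<exists>c. c \<epsilon> h \<and> x \<sqsubseteq> c)) \<and> (\<forall>c. c \<epsilon> h \<longrightarrow> (\<forall>x. x \<sqsubseteq> c \<longrightarrow> x \<epsilon> s))"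

definition hist :: "'a \<Rightarrow> bool" where
  "hist h \<longleftrightarrow> (\<forall>x. x \<epsilon> h \<longrightarrow>
     (\<forall>y. y \<epsilon> x \<longrightarrow> (\<exists>c. c \<epsilon> x \<and> (c \<epsilon> h \<and> y \<sqsubseteq> c))) \<and>
     (\<forall>c. c \<epsilon> x \<longrightarrow> (c \<epsilon> h \<longrightarrow> (\<forall>y. y \<sqsubseteq> c \<longrightarrow> y \<epsilon> x))))"

definition lev :: "'a \<Rightarrow> bool" where
  "lev s \<longleftrightarrow> (\<exists>h. h \<sqsubseteq> s \<and> (hist h \<and> pot h s))"

lemma df_lev: "tm t \<Longrightarrow> dp (\<lambda>e. lev (t e))"
  by (rule df_lift1) (unfold lev_def hist_def pot_def, intro df_intros)

text \<open>By induction on \<open>c\<close>: an element \<open>x\<close> of \<open>c\<close> is a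
  subset of some \<open>d\<close> in both \<open>c\<close> and \<open>h\<close>. Elements of
  \<open>x\<close> lie in \<open>d\<close>, which is transitive, so they are subsets of
  \<open>d\<close> and hence elements of \<open>c\<close>.\<close>

lemma hist_trans:
  assumes "hist h" "c \<epsilon> h"
  shows "trans_set c"
proof -
  have "c \<epsilon> h \<longrightarrow> trans_set c"
  proof (rule mem_induct[where R = "\<lambda>c. c \<epsilon> h \<longrightarrow> trans_set c"])
    show "dp (\<lambda>e. e 0 \<epsilon> h \<longrightarrow> trans_set (e 0))" by (intro df_intros df_trans_set)
  next
    fix c assume IH: "\<And>d. d \<epsilon> c \<Longrightarrow> d \<epsilon> h \<longrightarrow> trans_set d"
    show "c \<epsilon> h \<longrightarrow> trans_set c"
      unfolding trans_set_def
    proof (intro impI allI)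
      fix x assume c: "c \<epsilon> h" and x: "x \<epsilon> c"
      obtain d where d: "d \<epsilon> c" "d \<epsilon> h" "x \<sqsubseteq> d"
        using c x assms(1) unfolding hist_def by blast
      have "z \<epsilon> c" if "z \<epsilon> x" for z
      proof -
        have "z \<epsilon> d" using d(3) that by (rule subD)
        then have "z \<sqsubseteq> d" using IH d(1,2) unfolding trans_set_def by blast
        then show ?thesis using c d(1,2) assms(1) unfolding hist_def by blast
      qed
      then show "x \<sqsubseteq> c" by (simp add: sub_def)
    qed
  qed
  with assms(2) show ?thesis by blast
qed

text \<open>The intersection of \<open>c\<close> and \<open>h\<close> is a history of
  \<open>c\<close>. Since \<open>c\<close> is transitive, nothing that a member of the intersection
  relies on is lost.\<close>

lemma hist_lev:
  assumes "hist h" "c \<epsilon> h"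
  shows "lev c"
proof -
  have "\<exists>h'. \<forall>x. x \<epsilon> h' \<longleftrightarrow> x \<epsilon> c \<and> x \<epsilon> h"
    by (rule separation) (intro df_intros)
  then obtain h' where h': "\<forall>x. x \<epsilon> h' \<longleftrightarrow> x \<epsilon> c \<and> x \<epsilon> h" by blast
  have tr: "x \<epsilon> c" if "x \<epsilon> d" "d \<epsilon> c" for x d
    using trans_setD[OF hist_trans[OF assms]] that by blast
  have "hist h'"
    unfolding hist_def
  proof (intro allI impI conjI)
    fix x y assume "x \<epsilon> h'" "y \<epsilon> x"
    moreover from this obtain d where "d \<epsilon> x" "d \<epsilon> h" "y \<sqsubseteq> d"
      using assms(1) h' unfolding hist_def by blast
    ultimately show "\<exists>d. d \<epsilon> x \<and> d \<epsilon> h' \<and> y \<sqsubseteq> d" using h' tr by blast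
  next
    fix x d y assume "x \<epsilon> h'" "d \<epsilon> x" "d \<epsilon> h'" "y \<sqsubseteq> d"
    then show "y \<epsilon> x" using assms(1) h' unfolding hist_def by blast
  qed
  moreover have "pot h' c"
    using assms h' unfolding hist_def pot_def by blast
  moreover have "h' \<sqsubseteq> c" using h' by (simp add: sub_def)
  ultimately show ?thesis unfolding lev_def by blast
qed

lemma levE:
  assumes "lev s"
  obtains h where "h \<sqsubseteq> s" "hist h" "pot h s"
  using assms unfolding lev_def by blast

lemma pot_mem: "pot h s \<Longrightarrow> c \<epsilon> h \<Longrightarrow> x \<sqsubseteq> c \<Longrightarrow> x \<epsilon> s"
  unfolding pot_def by blast

lemma potE:
  assumes "pot h s" "x \<epsilon> s"
  obtains c where "c \<epsilon> h" "x \<sqsubseteq> c"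
  using assms unfolding pot_def by blast

lemma lev_super:
  assumes "lev s" "x \<epsilon> s" "y \<sqsubseteq> x"
  shows "y \<epsilon> s"
proof -
  obtain h where h: "pot h s" using assms(1) by (rule levE)
  obtain c where c: "c \<epsilon> h" "x \<sqsubseteq> c" using h assms(2) by (rule potE)
  show ?thesis by (rule pot_mem[OF h c(1) sub_trans[OF assms(3) c(2)]])
qed

lemma lev_elem:
  assumes "lev s" "x \<epsilon> s"
  shows "\<exists>r. r \<epsilon> s \<and> lev r \<and> x \<sqsubseteq> r"
proof -
  obtain h where h: "h \<sqsubseteq> s" "hist h" "pot h s" using assms(1) by (rule levE)
  obtain c where c: "c \<epsilon> h" "x \<sqsubseteq> c" using h(3) assms(2) by (rule potE)
  show ?thesis using subD[OF h(1) c(1)] hist_lev[OF h(2) c(1)] c(2) by blast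
qed

lemma lev_trans:
  assumes "lev s"
  shows "trans_set s"
  unfolding trans_set_def
proof (intro allI impI)
  fix x assume x: "x \<epsilon> s"
  obtain h where h: "hist h" "pot h s" using assms by (rule levE)
  obtain c where c: "c \<epsilon> h" "x \<sqsubseteq> c" using h(2) x by (rule potE)
  have "z \<epsilon> s" if "z \<epsilon> x" for z
  proof -
    have "z \<sqsubseteq> c" using hist_trans[OF h(1) c(1)] subD[OF c(2) that] unfolding trans_set_def by blast
    then show ?thesis by (rule pot_mem[OF h(2) c(1)])
  qed
  then show "x \<sqsubseteq> s" by (simp add: sub_def)
qed

text \<open>By nested induction. If \<open>s\<close> and \<open>t\<close> are incomparable, each
  element of \<open>s\<close> is a subset of a level \<open>r\<close> in \<open>s\<close>;
  \<open>r\<close> is comparable with \<open>t\<close>, and transitivity of \<open>s\<close> leaves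
  only that \<open>r\<close> is in \<open>t\<close>, so the element is in \<open>t\<close> too.
  Symmetrically \<open>t\<close> is included in \<open>s\<close>, and extensionality gives
  \<open>s = t\<close>.\<close>

lemma lev_linear:
  assumes "lev s" "lev t"
  shows "s \<epsilon> t \<or> s = t \<or> t \<epsilon> s"
proof -
  obtain p where p: "\<forall>x. x \<epsilon> p \<longleftrightarrow> x = s \<or> x = t" using ex_pair by blast
  \<comment> \<open>\<open>S\<close> bounds the quantifier over \<open>t\<close>, which makes the
    statement of the outer induction \<open>Delta0P\<close>.\<close>
  obtain S where S: "p \<sqsubseteq> S" "trans_set S" using ex_transitive unfolding trans_set_def by blast
  let ?C = "\<lambda>s t. s \<epsilon> t \<or> (s = t \<or> t \<epsilon> s)"
  have "s \<epsilon> S \<longrightarrow> (lev s \<longrightarrow> (\<forall>t. t \<epsilon> S \<longrightarrow> (lev t \<longrightarrow> ?C s t)))"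
  proof (rule mem_induct[where
        R = "\<lambda>s. s \<epsilon> S \<longrightarrow> (lev s \<longrightarrow> (\<forall>t. t \<epsilon> S \<longrightarrow> (lev t \<longrightarrow> ?C s t)))"])
    show "dp (\<lambda>e. e 0 \<epsilon> S \<longrightarrow> (lev (e 0) \<longrightarrow> (\<forall>t. t \<epsilon> S \<longrightarrow> (lev t \<longrightarrow> ?C (e 0) t))))"
      by (intro df_intros df_lev)
  next
    fix s assume IHs: "\<And>r. r \<epsilon> s \<Longrightarrow> r \<epsilon> S \<longrightarrow> (lev r \<longrightarrow> (\<forall>t. t \<epsilon> S \<longrightarrow> (lev t \<longrightarrow> ?C r t)))"
    show "s \<epsilon> S \<longrightarrow> (lev s \<longrightarrow> (\<forall>t. t \<epsilon> S \<longrightarrow> (lev t \<longrightarrow> ?C s t)))"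
    proof (intro impI allI)
      fix t assume s: "s \<epsilon> S" "lev s" and t: "t \<epsilon> S" "lev t"
      have "t \<epsilon> S \<longrightarrow> (lev t \<longrightarrow> ?C s t)"
      proof (rule mem_induct[where R = "\<lambda>t. t \<epsilon> S \<longrightarrow> (lev t \<longrightarrow> ?C s t)"])
        show "dp (\<lambda>e. e 0 \<epsilon> S \<longrightarrow> (lev (e 0) \<longrightarrow> ?C s (e 0)))" by (intro df_intros df_lev)
      next
        fix t assume IHt: "\<And>r. r \<epsilon> t \<Longrightarrow> r \<epsilon> S \<longrightarrow> (lev r \<longrightarrow> ?C s r)"
        show "t \<epsilon> S \<longrightarrow> (lev t \<longrightarrow> ?C s t)"
        proof (intro impI, rule ccontr)
          assume t: "t \<epsilon> S" "lev t" and no: "\<not> ?C s t"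
          have "x \<epsilon> t" if x: "x \<epsilon> s" for x
          proof -
            obtain r where r: "r \<epsilon> s" "lev r" "x \<sqsubseteq> r" using lev_elem[OF s(2) x] by blast
            have "r \<epsilon> S" using trans_setD[OF S(2) r(1) s(1)] .
            then have "?C r t" using IHs[OF r(1)] r(2) t by blast
            moreover have "\<not> t \<epsilon> r"
              using trans_setD[OF lev_trans[OF s(2)] _ r(1)] no by blast
            moreover have "r \<noteq> t" using r(1) no by blast
            ultimately show ?thesis using lev_super[OF t(2) _ r(3)] by blast
          qed
          moreover have "x \<epsilon> s" if x: "x \<epsilon> t" for x
          proof -
            obtain r where r: "r \<epsilon> t" "lev r" "x \<sqsubseteq> r" using lev_elem[OF t(2) x] by blast
            have "r \<epsilon> S" using trans_setD[OF S(2) r(1) t(1)] .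
            then have "?C s r" using IHt[OF r(1)] r(2) by blast
            moreover have "\<not> s \<epsilon> r"
              using trans_setD[OF lev_trans[OF t(2)] _ r(1)] no by blast
            moreover have "r \<noteq> s" using r(1) no by blast
            ultimately show ?thesis using lev_super[OF s(2) _ r(3)] by blast
          qed
          ultimately have "s = t" by (intro extensionality) blast
          with no show False by blast
        qed
      qed
      with t show "?C s t" by blast
    qed
  qed
  then show ?thesis using assms S(1) p by (simp add: sub_def)
qed

text \<open>Collection gathers levels that cover the elements of \<open>a\<close>. They generate a
  history \<open>h\<close>, and the level with this history contains every subset of a member of
  \<open>h\<close>, in particular every element of \<open>a\<close>.\<close>

lemma ex_lev: "\<exists>v. lev v \<and> a \<sqsubseteq> v"
proof (rule Sigma1P_induct[where R = "\<lambda>v a. lev v \<and> a \<sqsubseteq> v"])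
  show "dp (\<lambda>e. lev (e 0) \<and> e 1 \<sqsubseteq> e 0)" by (intro df_intros df_lev)
next
  fix a assume IH: "\<And>c. c \<epsilon> a \<Longrightarrow> \<exists>v. lev v \<and> c \<sqsubseteq> v"
  have "\<exists>C. \<forall>c. c \<epsilon> a \<longrightarrow> (\<exists>v. v \<epsilon> C \<and> (lev v \<and> c \<sqsubseteq> v))"
    by (rule collection) (intro df_intros df_lev, rule IH)
  then obtain C where C: "\<forall>c. c \<epsilon> a \<longrightarrow> (\<exists>v. v \<epsilon> C \<and> (lev v \<and> c \<sqsubseteq> v))" by blast
  obtain D where D: "C \<sqsubseteq> D" "\<forall>x y. x \<epsilon> y \<longrightarrow> y \<epsilon> C \<longrightarrow> x \<epsilon> D" using ex_union_closure by blast
  \<comment> \<open>\<open>C\<close> may contain other sets, so its levels are selected. Adding the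
    levels that are elements of these puts every level in a member of \<open>h\<close> into
    \<open>h\<close>, as a history requires.\<close>
  let ?P = "\<lambda>r. lev r \<and> (\<exists>s. s \<epsilon> C \<and> (lev s \<and> (r \<epsilon> s \<or> r = s)))"
  have "\<exists>h. \<forall>r. r \<epsilon> h \<longleftrightarrow> r \<epsilon> D \<and> ?P r"
    by (rule separation) (intro df_intros df_lev)
  then obtain h where "\<forall>r. r \<epsilon> h \<longleftrightarrow> r \<epsilon> D \<and> ?P r" by blast
  then have h: "r \<epsilon> h \<longleftrightarrow> ?P r" for r using D by (auto simp: sub_def)
  have h_lev: "c \<epsilon> h" if rc: "r \<epsilon> h" "c \<epsilon> r" "lev c" for r c
  proof -
    obtain s where s: "s \<epsilon> C" "lev s" "r \<epsilon> s \<or> r = s" using rc(1) h[of r] by blast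
    from s(3) have "c \<epsilon> s"
    proof
      assume "r \<epsilon> s"
      then show ?thesis by (rule trans_setD[OF lev_trans[OF s(2)] rc(2)])
    next
      assume "r = s"
      then show ?thesis using rc(2) by simp
    qed
    with s(1,2) rc(3) h[of c] show ?thesis by blast
  qed
  obtain U where U: "\<forall>x y. x \<sqsubseteq> y \<longrightarrow> y \<epsilon> h \<longrightarrow> x \<epsilon> U" using ex_subset_closure by blast
  have "\<exists>v. \<forall>x. x \<epsilon> v \<longleftrightarrow> x \<epsilon> U \<and> (\<exists>c. c \<epsilon> h \<and> x \<sqsubseteq> c)"
    by (rule separation) (intro df_intros)
  then obtain v where v: "\<forall>x. x \<epsilon> v \<longleftrightarrow> x \<epsilon> U \<and> (\<exists>c. c \<epsilon> h \<and> x \<sqsubseteq> c)" by blast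
  have "hist h"
    unfolding hist_def
  proof (intro allI impI conjI)
    fix x y assume "x \<epsilon> h" "y \<epsilon> x"
    then show "\<exists>c. c \<epsilon> x \<and> c \<epsilon> h \<and> y \<sqsubseteq> c" using lev_elem[of x y] h[of x] h_lev[of x _] by blast
  next
    fix x c y assume "x \<epsilon> h" "c \<epsilon> x" "c \<epsilon> h" "y \<sqsubseteq> c"
    then show "y \<epsilon> x" using lev_super[of x c y] h[of x] by blast
  qed
  moreover have "pot h v" unfolding pot_def using v U by blast
  moreover have "h \<sqsubseteq> v"
    unfolding sub_def[of _ h]
  proof (intro allI impI)
    fix c assume "c \<epsilon> h"
    with v U show "c \<epsilon> v" using sub_refl[of c] by blast
  qed
  ultimately have "lev v" unfolding lev_def by blast
  moreover have "a \<sqsubseteq> v"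
    unfolding sub_def
  proof (intro allI impI)
    fix c assume "c \<epsilon> a"
    then obtain s where s: "s \<epsilon> C" "lev s" "c \<sqsubseteq> s" using C by blast
    then have "s \<epsilon> h" using h[of s] by blast
    with s(3) v U show "c \<epsilon> v" by blast
  qed
  ultimately show "\<exists>v. lev v \<and> a \<sqsubseteq> v" by blast
qed

definition least_lev :: "('a \<Rightarrow> bool) \<Rightarrow> 'a \<Rightarrow> bool" where
  "least_lev P v \<longleftrightarrow> lev v \<and> P v \<and> (\<forall>w. w \<epsilon> v \<longrightarrow> \<not> (lev w \<and> P w))"

lemma ex_least_lev:
  assumes "dp (\<lambda>e. P (e 0))" "lev v" "P v"
  shows "\<exists>v. least_lev P v"
proof -
  have "dp (\<lambda>e. lev (e 0) \<and> P (e 0))" by (intro df_intros df_lev assms(1))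
  from foundation[OF this, of v] assms show ?thesis unfolding least_lev_def by blast
qed

lemma least_lev_unique: "least_lev P v \<Longrightarrow> least_lev P w \<Longrightarrow> v = w"
  unfolding least_lev_def using lev_linear[of v w] by blast


subsection \<open>Ordered pairs\<close>

definition dbl :: "'a \<Rightarrow> 'a \<Rightarrow> 'a \<Rightarrow> bool" where
  "dbl d a b \<longleftrightarrow> a \<epsilon> d \<and> b \<epsilon> d \<and> (\<forall>u. u \<epsilon> d \<longrightarrow> u = a \<or> u = b)"

text \<open>Kuratowski's pair \<open>{{a}, {a, b}}\<close>, described by quantifiers that are
  bounded by \<open>z\<close> and its elements.\<close>

definition is_pair :: "'a \<Rightarrow> 'a \<Rightarrow> 'a \<Rightarrow> bool" where
  "is_pair z a b \<longleftrightarrow> (\<exists>s. s \<epsilon> z \<and> dbl s a a) \<and> (\<exists>d. d \<epsilon> z \<and> dbl d a b) \<and>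
     (\<forall>w. w \<epsilon> z \<longrightarrow> dbl w a a \<or> dbl w a b)"

lemma df_is_pair: "tm t \<Longrightarrow> tm u \<Longrightarrow> tm v \<Longrightarrow> dp (\<lambda>e. is_pair (t e) (u e) (v e))"
  by (rule df_lift3) (unfold is_pair_def dbl_def, intro df_intros)

lemma is_pair_inj:
  assumes "is_pair z a b" "is_pair z a' b'"
  shows "a = a'" "b = b'"
proof -
  obtain s where s: "s \<epsilon> z" "dbl s a a" using assms(1) unfolding is_pair_def by blast
  then have "dbl s a' a' \<or> dbl s a' b'" using assms(2) unfolding is_pair_def by blast
  then have "a' \<epsilon> s" unfolding dbl_def by blast
  then show a: "a = a'" using s(2) unfolding dbl_def by blast
  obtain d where d: "d \<epsilon> z" "dbl d a b" using assms(1) unfolding is_pair_def by blast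
  then have d': "dbl d a a \<or> dbl d a b'" using assms(2) a unfolding is_pair_def by blast
  obtain f where f: "f \<epsilon> z" "dbl f a b'" using assms(2) a unfolding is_pair_def by blast
  then have f': "dbl f a a \<or> dbl f a b" using assms(1) unfolding is_pair_def by blast
  have "b = a \<or> b = b'" using d(2) d' unfolding dbl_def by blast
  moreover have "b' = a \<or> b' = b" using f(2) f' unfolding dbl_def by blast
  ultimately show "b = b'" by blast
qed

lemma ex_is_pair: "\<exists>z. is_pair z a b"
proof -
  have dbl: "\<exists>d. dbl d a b" for a b using ex_pair[of a b] unfolding dbl_def by blast
  obtain s d where s: "dbl s a a" "dbl d a b" using dbl by blast
  obtain z where z: "\<forall>x. x \<epsilon> z \<longleftrightarrow> x = s \<or> x = d" using ex_pair by blast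
  then show ?thesis using s unfolding is_pair_def by (intro exI[of _ z]) auto
qed

definition pair_in :: "'a \<Rightarrow> 'a \<Rightarrow> 'a \<Rightarrow> bool" where
  "pair_in f a b \<longleftrightarrow> (\<exists>z. z \<epsilon> f \<and> is_pair z a b)"

lemma df_pair_in: "tm t \<Longrightarrow> tm u \<Longrightarrow> tm v \<Longrightarrow> dp (\<lambda>e. pair_in (t e) (u e) (v e))"
  by (rule df_lift3) (unfold pair_in_def, intro df_intros df_is_pair)

lemma is_pair_components: "is_pair z a b \<Longrightarrow> \<exists>d. d \<epsilon> z \<and> a \<epsilon> d \<and> b \<epsilon> d"
  unfolding is_pair_def dbl_def by blast

text \<open>Both components of a pair lie two unions below \<open>f\<close>. Such a set
  \<open>V\<close> bounds quantifiers over values in the uniqueness induction.\<close>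

lemma ex_field: "\<exists>V. \<forall>a b. pair_in f a b \<longrightarrow> a \<epsilon> V \<and> b \<epsilon> V"
proof -
  obtain U where U: "\<forall>x y. x \<epsilon> y \<longrightarrow> y \<epsilon> f \<longrightarrow> x \<epsilon> U" using ex_union_closure by blast
  obtain V where "\<forall>x y. x \<epsilon> y \<longrightarrow> y \<epsilon> U \<longrightarrow> x \<epsilon> V" using ex_union_closure by blast
  with U show ?thesis using is_pair_components unfolding pair_in_def by blast
qed

text \<open>The value is sought inside an element \<open>d\<close> of the pair, which keeps the
  predicate \<open>Delta0P\<close>.\<close>

definition in_dom :: "'a \<Rightarrow> 'a \<Rightarrow> bool" where
  "in_dom f a \<longleftrightarrow> (\<exists>z. z \<epsilon> f \<and> (\<exists>d. d \<epsilon> z \<and> (\<exists>v. v \<epsilon> d \<and> is_pair z a v)))"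

lemma df_in_dom: "tm t \<Longrightarrow> tm u \<Longrightarrow> dp (\<lambda>e. in_dom (t e) (u e))"
  by (rule df_lift2) (unfold in_dom_def, intro df_intros df_is_pair)

lemma in_dom_iff: "in_dom f a \<longleftrightarrow> (\<exists>v. pair_in f a v)"
  unfolding in_dom_def pair_in_def using is_pair_components by blast

end


section \<open>Descending through a \<open>\<Sigma>\<^sub>1\<close> class\<close>

text \<open>The assumption \<open>descent\<close> is the negation of the desired conclusion. The set
  \<open>T\<close> is where the descent takes place, and \<open>s0\<close> holds the witnesses from
  which it starts.\<close>

locale kpp_descent = kpp +
  fixes \<theta> :: "'a \<Rightarrow> 'a \<Rightarrow> bool" and T s0 :: 'a
  assumes df_\<theta>0: "dp (\<lambda>e. \<theta> (e 0) (e 1))"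
    and descent: "\<theta> y x \<Longrightarrow> \<exists>z. z \<epsilon> x \<and> (\<exists>y. \<theta> y z)"
begin

lemma df_\<theta>: "tm t \<Longrightarrow> tm u \<Longrightarrow> dp (\<lambda>e. \<theta> (t e) (u e))"
  by (rule df_lift2[OF df_\<theta>0])

definition good :: "'a \<Rightarrow> 'a \<Rightarrow> bool" where
  "good u v \<longleftrightarrow> (\<forall>x. x \<epsilon> T \<longrightarrow> (\<exists>y. y \<epsilon> u \<and> \<theta> y x) \<longrightarrow>
     (\<exists>z. z \<epsilon> x \<and> (\<exists>y. y \<epsilon> v \<and> \<theta> y z)))"

lemma df_good: "tm t \<Longrightarrow> tm u \<Longrightarrow> dp (\<lambda>e. good (t e) (u e))"
  by (rule df_lift2) (unfold good_def, intro df_intros df_\<theta>)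

lemma good_mono:
  assumes "good u v" "v \<sqsubseteq> w"
  shows "good u w"
  unfolding good_def
proof (intro allI impI)
  fix x assume "x \<epsilon> T" "\<exists>y. y \<epsilon> u \<and> \<theta> y x"
  then obtain z y where "z \<epsilon> x" "y \<epsilon> v" "\<theta> y z" using assms(1) unfolding good_def by blast
  with subD[OF assms(2), of y] show "\<exists>z. z \<epsilon> x \<and> (\<exists>y. y \<epsilon> w \<and> \<theta> y z)" by blast
qed

lemma ex_good: "\<exists>v. good u v"
proof -
  \<comment> \<open>The condition that \<open>x\<close> has a witness in \<open>u\<close> is part of
    the collected formula, so collection applies to all of \<open>T\<close>; any \<open>y\<close>
    serves for the other elements.\<close>
  have "\<exists>C. \<forall>x. x \<epsilon> T \<longrightarrow>
    (\<exists>y. y \<epsilon> C \<and> ((\<exists>y. y \<epsilon> u \<and> \<theta> y x) \<longrightarrow> (\<exists>z. z \<epsilon> x \<and> \<theta> y z)))"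
    by (rule collection) (intro df_intros df_\<theta>, use descent in blast)
  then obtain C where C: "\<forall>x. x \<epsilon> T \<longrightarrow>
    (\<exists>y. y \<epsilon> C \<and> ((\<exists>y. y \<epsilon> u \<and> \<theta> y x) \<longrightarrow> (\<exists>z. z \<epsilon> x \<and> \<theta> y z)))" by blast
  have "good u C"
    unfolding good_def using C by blast
  then show ?thesis by blast
qed

text \<open>The hierarchy of bounds: \<open>v\<close> is admissible at \<open>b\<close> if it collects witnesses for one more
  step of descent from each bound attained below \<open>b\<close>. The least such level is unique, so no
  choice is needed to iterate, and \<open>att f\<close> says that \<open>f\<close> is a partial graph of the recursion.\<close>

definition req :: "'a \<Rightarrow> 'a \<Rightarrow> 'a \<Rightarrow> bool" where
  "req f b v \<longleftrightarrow> s0 \<sqsubseteq> v \<and> (\<forall>c. c \<epsilon> b \<longrightarrow> (\<exists>u. u \<epsilon> v \<and> (pair_in f c u \<and> good u v)))"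

lemma df_req: "tm t \<Longrightarrow> tm u \<Longrightarrow> tm v \<Longrightarrow> dp (\<lambda>e. req (t e) (u e) (v e))"
  by (rule df_lift3) (unfold req_def, intro df_intros df_good df_pair_in)

abbreviation step :: "'a \<Rightarrow> 'a \<Rightarrow> 'a \<Rightarrow> bool" where
  "step f b \<equiv> least_lev (req f b)"

lemma df_step: "tm t \<Longrightarrow> tm u \<Longrightarrow> tm v \<Longrightarrow> dp (\<lambda>e. step (t e) (u e) (v e))"
  by (rule df_lift3[where R = "\<lambda>f b v. step f b v"])
    (unfold least_lev_def, intro df_intros df_lev df_req)

definition att :: "'a \<Rightarrow> bool" where
  "att f \<longleftrightarrow> (\<forall>z. z \<epsilon> f \<longrightarrow> (\<forall>d. d \<epsilon> z \<longrightarrow> (\<forall>b. b \<epsilon> d \<longrightarrow> (\<forall>v. v \<epsilon> d \<longrightarrow>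
     (is_pair z b v \<longrightarrow> step f b v)))))"

lemma df_att: "tm t \<Longrightarrow> dp (\<lambda>e. att (t e))"
  by (rule df_lift1) (unfold att_def, intro df_intros df_step df_is_pair)

section \<open>Uniqueness, union and existence of partial graphs of the recursion\<close>

lemma attD: "att f \<Longrightarrow> pair_in f b v \<Longrightarrow> step f b v"
  unfolding att_def pair_in_def using is_pair_components by blast

lemma attI: "(\<And>b v. pair_in f b v \<Longrightarrow> step f b v) \<Longrightarrow> att f"
  unfolding att_def pair_in_def by blast

lemma step_req: "step f b v \<Longrightarrow> req f b v"
  unfolding least_lev_def by blast

lemma req_below: "req f b v \<Longrightarrow> c \<epsilon> b \<Longrightarrow> \<exists>u. u \<epsilon> v \<and> pair_in f c u \<and> good u v"
  unfolding req_def by blast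

text \<open>\<open>req f b\<close> consults \<open>f\<close> only at elements of \<open>b\<close>.
  This locality is what allows partial graphs to be compared, united and extended.\<close>

lemma step_cong:
  assumes "\<And>c u. c \<epsilon> b \<Longrightarrow> pair_in f c u \<longleftrightarrow> pair_in g c u"
  shows "step f b = step g b"
proof -
  have "req f b = req g b" unfolding req_def using assms by (intro ext) blast
  then show ?thesis by simp
qed

lemma att_unique:
  assumes f: "att f" and g: "att g" and "pair_in f b v" "pair_in g b w"
  shows "v = w"
proof -
  obtain V where V: "\<forall>a b. pair_in f a b \<longrightarrow> a \<epsilon> V \<and> b \<epsilon> V" using ex_field by blast
  obtain W where W: "\<forall>a b. pair_in g a b \<longrightarrow> a \<epsilon> W \<and> b \<epsilon> W" using ex_field by blast
  let ?R = "\<lambda>b. \<forall>v. v \<epsilon> V \<longrightarrow> (\<forall>w. w \<epsilon> W \<longrightarrow> (pair_in f b v \<longrightarrow> (pair_in g b w \<longrightarrow> v = w)))"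
  have "?R b"
  proof (rule mem_induct[where R = ?R])
    show "dp (\<lambda>e. ?R (e 0))" by (intro df_intros df_pair_in)
  next
    fix b assume "\<And>c. c \<epsilon> b \<Longrightarrow> ?R c"
    then have IH: "u = u'" if "c \<epsilon> b" "pair_in f c u" "pair_in g c u'" for c u u'
      using that V W by blast
    show "?R b"
    proof (intro allI impI)
      fix v w assume v: "pair_in f b v" and w: "pair_in g b w"
      \<comment> \<open>\<open>req\<close> demands a value at every element of \<open>b\<close>, so
        both graphs are defined at \<open>c\<close>, and there the induction hypothesis makes them
        agree.\<close>
      have "pair_in f c u \<longleftrightarrow> pair_in g c u" if c: "c \<epsilon> b" for c u
      proof -
        obtain u1 where u1: "pair_in f c u1" using req_below[OF step_req[OF attD[OF f v]] c] by blast
        obtain u2 where u2: "pair_in g c u2" using req_below[OF step_req[OF attD[OF g w]] c] by blast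
        show ?thesis using u1 u2 IH[OF c, of u] IH[OF c, of u1] IH[OF c, of u1 u2] by blast
      qed
      then have "step f b = step g b" by (rule step_cong)
      then show "v = w" using attD[OF f v] attD[OF g w] least_lev_unique by simp
    qed
  qed
  with V W assms(3,4) show ?thesis by blast
qed

text \<open>Partial graphs agree where both are defined, and each is defined at all elements of its
  arguments. So below an argument of \<open>g\<close> the union coincides with
  \<open>g\<close>.\<close>

lemma att_Union:
  assumes F: "\<And>b v. pair_in F b v \<longleftrightarrow> (\<exists>g. g \<epsilon> C \<and> att g \<and> pair_in g b v)"
  shows "att F"
proof (rule attI)
  fix b v assume "pair_in F b v"
  then obtain g where g: "g \<epsilon> C" "att g" "pair_in g b v" using F[of b v] by blast
  have "pair_in g c u \<longleftrightarrow> pair_in F c u" if c: "c \<epsilon> b" for c u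
  proof
    show "pair_in g c u \<Longrightarrow> pair_in F c u" using F[of c u] g(1,2) by blast
  next
    assume "pair_in F c u"
    then obtain g' where g': "att g'" "pair_in g' c u" using F[of c u] by blast
    obtain u' where u': "pair_in g c u'" using req_below[OF step_req[OF attD[OF g(2,3)]] c] by blast
    then show "pair_in g c u" using att_unique[OF g'(1) g(2) g'(2) u'] by simp
  qed
  then have "step g b = step F b" by (rule step_cong)
  then show "step F b v" using attD[OF g(2,3)] by simp
qed

text \<open>Since \<open>good\<close> is monotone in its second place, one level that includes all
  collected bounds and \<open>s0\<close> works for every element of \<open>a\<close> at once;
  foundation then provides a least such level.\<close>

lemma ex_step:
  assumes "\<And>c. c \<epsilon> a \<Longrightarrow> \<exists>u. pair_in F c u"
  shows "\<exists>v. step F a v"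
proof -
  let ?R = "\<lambda>t c. \<exists>u. u \<epsilon> t \<and> (pair_in F c u \<and> good u t)"
  have R: "\<exists>t. ?R t c" if c: "c \<epsilon> a" for c
  proof -
    obtain u where u: "pair_in F c u" using assms[OF c] by blast
    obtain t where t: "good u t" using ex_good by blast
    \<comment> \<open>The value \<open>u\<close> is added because \<open>req\<close> wants it as an
      element of the bound.\<close>
    obtain w where w: "\<forall>x. x \<epsilon> w \<longleftrightarrow> x \<epsilon> t \<or> x = u" using ex_insert by blast
    then have "good u w" by (intro good_mono[OF t]) (simp add: sub_def)
    with u w show ?thesis by blast
  qed
  have "\<exists>D. \<forall>c. c \<epsilon> a \<longrightarrow> (\<exists>t. t \<epsilon> D \<and> ?R t c)"
    by (rule collection) (intro df_intros df_pair_in df_good, rule R)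
  then obtain D where D: "\<forall>c. c \<epsilon> a \<longrightarrow> (\<exists>t. t \<epsilon> D \<and> ?R t c)" by blast
  obtain D' where D': "\<forall>x. x \<epsilon> D' \<longleftrightarrow> (\<exists>t. t \<epsilon> D \<and> x \<epsilon> t)" using ex_union by blast
  obtain w where w: "\<forall>x. x \<epsilon> w \<longleftrightarrow> x \<epsilon> D' \<or> x \<epsilon> s0" using ex_un by blast
  obtain v where v: "lev v" "w \<sqsubseteq> v" using ex_lev by blast
  have "req F a v"
    unfolding req_def
  proof (intro conjI allI impI)
    show "s0 \<sqsubseteq> v" using v(2) w by (simp add: sub_def)
  next
    fix c assume "c \<epsilon> a"
    then obtain t u where t: "t \<epsilon> D" "u \<epsilon> t" "pair_in F c u" "good u t" using D by blast
    have "t \<sqsubseteq> v" using v(2) w D' t(1) by (auto simp: sub_def)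
    with t show "\<exists>u. u \<epsilon> v \<and> pair_in F c u \<and> good u v"
      using good_mono[OF t(4)] subD[of t v u] by blast
  qed
  moreover have "dp (\<lambda>e. req F a (e 0))" by (intro df_req tm_intros)
  ultimately show ?thesis using ex_least_lev v(1) by blast
qed

lemma ex_att: "\<exists>f. att f \<and> in_dom f a"
proof (rule Sigma1P_induct[where R = "\<lambda>f a. att f \<and> in_dom f a"])
  show "dp (\<lambda>e. att (e 0) \<and> in_dom (e 0) (e 1))" by (intro df_intros df_att df_in_dom)
next
  fix a assume IH: "\<And>c. c \<epsilon> a \<Longrightarrow> \<exists>f. att f \<and> in_dom f c"
  have "\<exists>C. \<forall>c. c \<epsilon> a \<longrightarrow> (\<exists>f. f \<epsilon> C \<and> (att f \<and> in_dom f c))"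
    by (rule collection) (intro df_intros df_att df_in_dom, rule IH)
  then obtain C where C: "\<forall>c. c \<epsilon> a \<longrightarrow> (\<exists>f. f \<epsilon> C \<and> (att f \<and> in_dom f c))" by blast
  obtain U where U: "\<forall>z. z \<epsilon> U \<longleftrightarrow> (\<exists>g. g \<epsilon> C \<and> z \<epsilon> g)" using ex_union by blast
  \<comment> \<open>Collection may put other sets into \<open>C\<close>, so only its partial graphs
    enter the union.\<close>
  have "\<exists>F. \<forall>z. z \<epsilon> F \<longleftrightarrow> z \<epsilon> U \<and> (\<exists>g. g \<epsilon> C \<and> (att g \<and> z \<epsilon> g))"
    by (rule separation) (intro df_intros df_att)
  then obtain F where F: "\<forall>z. z \<epsilon> F \<longleftrightarrow> z \<epsilon> U \<and> (\<exists>g. g \<epsilon> C \<and> (att g \<and> z \<epsilon> g))" by blast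
  have F_iff: "pair_in F b v \<longleftrightarrow> (\<exists>g. g \<epsilon> C \<and> att g \<and> pair_in g b v)" for b v
    unfolding pair_in_def using F U by blast
  have attF: "att F" using F_iff by (rule att_Union)
  show "\<exists>f. att f \<and> in_dom f a"
  proof (cases "in_dom F a")
    case False
    have "\<exists>u. pair_in F c u" if "c \<epsilon> a" for c
      using that C F_iff[of c] in_dom_iff[of _ c] by blast
    then obtain v where v: "step F a v" using ex_step by blast
    obtain z where z: "is_pair z a v" using ex_is_pair by blast
    obtain F' where F': "\<forall>x. x \<epsilon> F' \<longleftrightarrow> x \<epsilon> F \<or> x = z" using ex_insert by blast
    have F'_iff: "pair_in F' b w \<longleftrightarrow> pair_in F b w \<or> (b = a \<and> w = v)" for b w
    proof -
      have "pair_in F' b w \<longleftrightarrow> pair_in F b w \<or> is_pair z b w"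
        unfolding pair_in_def using F' by auto
      then show ?thesis using is_pair_inj[OF z, of b w] z by blast
    qed
    have "att F'"
    proof (rule attI)
      fix b w assume "pair_in F' b w"
      \<comment> \<open>The new argument \<open>a\<close> is not an element of an old argument, as
        \<open>F\<close> would then already be defined at \<open>a\<close>, and it is not an element
        of itself. So the added pair changes no step.\<close>
      then have bw: "step F b w \<and> \<not> a \<epsilon> b"
      proof (cases "pair_in F b w")
        case True
        then show ?thesis
          using attD[OF attF True] req_below[OF step_req, of F b w a] False in_dom_iff by blast
      next
        case False
        then have "b = a" "w = v" using \<open>pair_in F' b w\<close> F'_iff by blast+
        with v mem_irrefl show ?thesis by simp
      qed
      have "step F b = step F' b"
      proof (rule step_cong)
        fix c u assume "c \<epsilon> b"
        with bw have "c \<noteq> a" by blast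
        then show "pair_in F c u \<longleftrightarrow> pair_in F' c u" using F'_iff by simp
      qed
      with bw show "step F' b w" by simp
    qed
    moreover have "in_dom F' a" using F'_iff in_dom_iff by blast
    ultimately show ?thesis by blast
  qed (use attF in blast)
qed

text \<open>Along an infinite set closed under successor the bounds attained are jointly closed under
  descent, so the elements of \<open>T\<close> with a witness below them form a set without a minimal
  element.\<close>

lemma no_witness:
  assumes "trans_set T" "x0 \<epsilon> T" "y0 \<epsilon> s0"
  shows "\<not> \<theta> y0 x0"
proof
  assume \<theta>: "\<theta> y0 x0"
  obtain w where "(\<exists>z. z \<epsilon> w \<and> (\<forall>x. \<not> x \<epsilon> z)) \<and>
     (\<forall>y. y \<epsilon> w \<longrightarrow> (\<exists>s. s \<epsilon> w \<and> (\<forall>x. x \<epsilon> s \<longleftrightarrow> x \<epsilon> y \<or> x = y)))"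
    using ex_infinite by blast
  then obtain o' where o': "o' \<epsilon> w"
    and suc: "\<And>y. y \<epsilon> w \<Longrightarrow> \<exists>s. s \<epsilon> w \<and> y \<epsilon> s" by blast
  \<comment> \<open>The recursion is evaluated at \<open>w\<close> itself: its value
    \<open>v\<close> has the bounds attained at elements of \<open>w\<close> as elements, and thus
    bounds the quantifier over \<open>u\<close> in \<open>?P\<close>.\<close>
  obtain f v where f: "att f" "pair_in f w v" using ex_att[of w] in_dom_iff by blast
  have w: "\<exists>u. u \<epsilon> v \<and> pair_in f c u" if "c \<epsilon> w" for c
    using req_below[OF step_req[OF attD[OF f]] that] by blast
  let ?P = "\<lambda>x. x \<epsilon> T \<and> (\<exists>u. u \<epsilon> v \<and> (\<exists>c. c \<epsilon> w \<and> (pair_in f c u \<and> (\<exists>y. y \<epsilon> u \<and> \<theta> y x))))"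
  obtain u where u: "u \<epsilon> v" "pair_in f o' u" using w[OF o'] by blast
  have "s0 \<sqsubseteq> u" using step_req[OF attD[OF f(1) u(2)]] unfolding req_def by blast
  then have "y0 \<epsilon> u" using assms(3) by (rule subD)
  then have P: "?P x0" using assms(2) u o' \<theta> by blast
  have "dp (\<lambda>e. ?P (e 0))" by (intro df_intros df_pair_in df_\<theta>)
  then have "\<exists>m. ?P m \<and> (\<forall>z. z \<epsilon> m \<longrightarrow> \<not> ?P z)"
    by (rule foundation[where R = ?P]) (rule P)
  then obtain m u c where m: "m \<epsilon> T" "c \<epsilon> w" "pair_in f c u" "\<exists>y. y \<epsilon> u \<and> \<theta> y m"
    and min: "\<And>z. z \<epsilon> m \<Longrightarrow> \<not> ?P z" by blast
  \<comment> \<open>The bound \<open>u'\<close> at \<open>c'\<close> is good for the one attained at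
    \<open>c\<close>, which is \<open>u\<close> by uniqueness. So some element of \<open>m\<close>
    has a witness in \<open>u'\<close>, against minimality.\<close>
  obtain c' where c': "c' \<epsilon> w" "c \<epsilon> c'" using suc[OF m(2)] by blast
  obtain u' where u': "u' \<epsilon> v" "pair_in f c' u'" using w[OF c'(1)] by blast
  obtain u2 where u2: "pair_in f c u2" "good u2 u'"
    using req_below[OF step_req[OF attD[OF f(1) u'(2)]] c'(2)] by blast
  have "u2 = u" by (rule att_unique[OF f(1) f(1) u2(1) m(3)])
  then obtain z y where z: "z \<epsilon> m" "y \<epsilon> u'" "\<theta> y z" using u2(2) m(1,4) unfolding good_def by blast
  have "z \<epsilon> T" using trans_setD[OF assms(1) z(1) m(1)] .
  then have "?P z" using u' c'(1) z(2,3) by blast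
  with min[OF z(1)] show False by blast
qed

end

section \<open>Foundation for existential formulae and for all of \<open>Sigma1P\<close>\<close>

lemma (in kpp) foundation_Ex:
  assumes \<theta>: "dp (\<lambda>e. \<theta> (e 0) (e 1))" "\<theta> y0 x0"
  shows "\<exists>x. (\<exists>y. \<theta> y x) \<and> (\<forall>z. z \<epsilon> x \<longrightarrow> (\<nexists>y. \<theta> y z))"
proof (rule ccontr)
  assume no: "\<not> ?thesis"
  obtain p where p: "\<forall>x. x \<epsilon> p \<longleftrightarrow> x = x0 \<or> x = x0" using ex_pair by blast
  obtain s0 where s0: "\<forall>x. x \<epsilon> s0 \<longleftrightarrow> x = y0 \<or> x = y0" using ex_pair by blast
  obtain T where T: "p \<sqsubseteq> T" "trans_set T" using ex_transitive unfolding trans_set_def by blast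
  interpret kpp_descent E \<theta> T s0
    by unfold_locales (use \<theta>(1) no in blast)+
  have "x0 \<epsilon> T" using p by (intro subD[OF T(1)]) simp
  then show False using no_witness[OF T(2)] s0 \<theta>(2) by blast
qed

text \<open>A block of existential quantifiers is bounded by a single one using pairing.\<close>

lemma (in kpp) Sigma1P_normal:
  assumes "q \<in> Sigma1P"
  shows "\<exists>R. dp (\<lambda>e. R (e 0) (\<lambda>i. e (Suc i))) \<and> (\<forall>e. sat E q e \<longleftrightarrow> (\<exists>b. R b e))"
  using assms
proof induction
  case (1 q)
  then have "dp (\<lambda>e. sat E q (\<lambda>i. e (Suc i)))"
    by (intro dfI[of q _ "\<lambda>i e. e (Suc i)"] tm_intros) auto
  then show ?case by (intro exI[of _ "\<lambda>b. sat E q"]) simp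
next
  case (2 q)
  then obtain R where R: "dp (\<lambda>e. R (e 0) (\<lambda>i. e (Suc i)))"
    "\<forall>e. sat E q e \<longleftrightarrow> (\<exists>b. R b e)" by blast
  \<comment> \<open>Any set \<open>p\<close> with both values among its elements codes them, so the
    two quantifiers become bounded by \<open>p\<close>.\<close>
  let ?S = "\<lambda>p e. \<exists>x. x \<epsilon> p \<and> (\<exists>b. b \<epsilon> p \<and> R b (case_nat x e))"
  \<comment> \<open>Inside the two bounded quantifiers index 0 is \<open>b\<close>, index 1 is
    \<open>x\<close> and index 2 is \<open>p\<close>, which \<open>R\<close> has to skip.\<close>
  let ?s = "case_nat (\<lambda>e. e 0) (case_nat (\<lambda>e. e (Suc 0)) (\<lambda>i e. e (Suc (Suc (Suc i)))))"
  have "dp (\<lambda>e. R (?s 0 e) (\<lambda>i. ?s (Suc i) e))"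
    by (rule df_subst[OF R(1)]) (intro tm_case_nat tm_intros)
  moreover have "(\<lambda>i. ?s (Suc i) e) = case_nat (e (Suc 0)) (\<lambda>i. e (Suc (Suc (Suc i))))"
    for e :: "nat \<Rightarrow> 'a"
    by (rule ext) (simp split: nat.split)
  ultimately have "dp (\<lambda>e. R (e 0) (case_nat (e (Suc 0)) (\<lambda>i. e (Suc (Suc (Suc i))))))" by simp
  then have "dp (\<lambda>e. ?S (e 0) (\<lambda>i. e (Suc i)))"
    by (intro Delta0P.df_ex tm_intros)
  moreover have "sat E (Ex q) e \<longleftrightarrow> (\<exists>p. ?S p e)" for e
  proof
    assume "sat E (Ex q) e"
    then obtain x where "sat E q (case_nat x e)" unfolding sat.simps by blast
    then obtain b where "R b (case_nat x e)" using R(2)[rule_format, of "case_nat x e"] by blast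
    moreover obtain p where "\<forall>z. z \<epsilon> p \<longleftrightarrow> z = x \<or> z = b" using ex_pair by blast
    ultimately show "\<exists>p. ?S p e" by blast
  next
    assume "\<exists>p. ?S p e"
    then obtain x b where "R b (case_nat x e)" by blast
    then have "sat E q (case_nat x e)" using R(2)[rule_format, of "case_nat x e"] by blast
    then show "sat E (Ex q) e" unfolding sat.simps by blast
  qed
  ultimately show ?case by (intro exI[of _ ?S]) simp
qed

lemma (in kpp) foundation_Sigma1P:
  assumes "q \<in> Sigma1P" "sat E q (case_nat x0 \<rho>)"
  shows "\<exists>x. sat E q (case_nat x \<rho>) \<and> (\<forall>z. z \<epsilon> x \<longrightarrow> \<not> sat E q (case_nat z \<rho>))"
proof -
  obtain R where R: "dp (\<lambda>e. R (e 0) (\<lambda>i. e (Suc i)))" "\<forall>e. sat E q e \<longleftrightarrow> (\<exists>b. R b e)"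
    using Sigma1P_normal[OF assms(1)] by blast
  \<comment> \<open>The parameters \<open>\<rho>\<close> become constant terms, leaving only the
    witness and the argument as variables.\<close>
  let ?s = "case_nat (\<lambda>e. e 0) (case_nat (\<lambda>e. e 1) (\<lambda>i e. \<rho> i))"
  have "dp (\<lambda>e. R (?s 0 e) (\<lambda>i. ?s (Suc i) e))"
    by (rule df_subst[OF R(1)]) (intro tm_case_nat tm_intros)
  moreover have "(\<lambda>i. ?s (Suc i) e) = case_nat (e 1) \<rho>" for e :: "nat \<Rightarrow> 'a"
    by (rule ext) (simp split: nat.split)
  ultimately have "dp (\<lambda>e. R (e 0) (case_nat (e 1) \<rho>))" by simp
  note foundation = foundation_Ex[where \<theta> = "\<lambda>b x. R b (case_nat x \<rho>)", OF this]
  have sat: "sat E q (case_nat x \<rho>) \<longleftrightarrow> (\<exists>b. R b (case_nat x \<rho>))" for x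
    using R(2) by (rule spec)
  obtain b where "R b (case_nat x0 \<rho>)" using assms(2) unfolding sat by blast
  then show ?thesis unfolding sat by (rule foundation)
qed

theorem corollary3p6:
  fixes \<phi> :: fm
  assumes "\<phi> \<in> Foundation Sigma1P"
  shows "KPP \<turnstile> \<phi>"
proof (rule KPP_complete)
  show "fv \<phi> = {}" using assms by (rule fv_Foundation)
next
  fix E :: "nat \<Rightarrow> nat \<Rightarrow> bool" and e
  assume "\<And>q e. q \<in> KPP \<Longrightarrow> sat E q e"
  then interpret kpp E by unfold_locales
  obtain n q where \<phi>: "\<phi> = (All ^^ n) (Imp (Ex q) (Ex (And q (AllIn 0 (Neg (ren (up Suc) q))))))"
    and q: "q \<in> Sigma1P"
    using assms unfolding Foundation_def by blast
  have "sat E (Imp (Ex q) (Ex (And q (AllIn 0 (Neg (ren (up Suc) q)))))) \<rho>" for \<rho>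
    using foundation_Sigma1P[OF q] by (auto simp: sat_ren case_nat_up)
  then show "sat E \<phi> e" unfolding \<phi> using sat_Alls by blast
qed

end
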